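(* Let $f\in L^2(S^1,\sigma)$ be an extremizer, i.e. $f\neq 0$ and $\|\widehat{f\sigma}\|_{L^6(\mathbb{R}^2)}=\mathcal{R}\,\|f\|_{L^2(S^1,\sigma)}$. Then $|f(-x)|=|f(x)|$ for $\sigma$-almost every $x\in S^1$.
   Context: $S^1\subset\mathbb{R}^2$ is the unit circle and $\sigma$ is its surface (arc length) measure. For complex-valued $f\in L^2(S^1,\sigma)$, $\widehat{f\sigma}(\xi)=\int_{S^1}e^{-i\xi\cdot x}f(x)\,d\sigma(x)$ for $\xi\in\mathbb{R}^2$. The optimal constant is $\mathcal{R}:=\sup\{\|\widehat{f\sigma}\|_{L^6(\mathbb{R}^2)}:\ \|f\|_{L^2(S^1,\sigma)}=1\}$, which is finite by the Tomas-Stein inequality. *)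

theory Defs
  imports "HOL-Analysis.Analysis"
begin

text \<open>The integral is taken in the extended nonnegative reals, so that the norm of a function
  outside \<open>L\<^sup>p\<close> is \<open>\<infinity>\<close> and not a default value. Intended for real \<open>p > 0\<close>.\<close>

definition Lp_norm :: "real \<Rightarrow> 'a measure \<Rightarrow> ('a \<Rightarrow> complex) \<Rightarrow> ennreal" where
  "Lp_norm p M f =
     (let I = (\<integral>\<^sup>+ x. ennreal (norm (f x) powr p) \<partial>M)
      in if I = \<infinity> then \<infinity> else ennreal (enn2real I powr (1 / p)))"

definition in_Lp :: "real \<Rightarrow> 'a measure \<Rightarrow> ('a \<Rightarrow> complex) \<Rightarrow> bool" where
  "in_Lp p M f \<longleftrightarrow> f \<in> borel_measurable M \<and> Lp_norm p M f < \<infinity>"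

abbreviation S1 :: "(real ^ 2) set" where
  "S1 \<equiv> sphere 0 1"

definition circle_param :: "real \<Rightarrow> real ^ 2" where
  "circle_param t = vector [cos t, sin t]"

text \<open>Arc length measure: the image of Lebesgue measure under the unit-speed parametrization.
  Its underlying space is the circle, so only the values on the circle of a function
  on the plane matter. It is not normalized; the total mass is \<open>2\<pi>\<close>.\<close>

definition arc_measure :: "(real ^ 2) measure" where
  "arc_measure =
     distr (restrict_space lborel {0..<2 * pi}) (restrict_space borel S1) circle_param"

definition fourier_ext :: "(real ^ 2 \<Rightarrow> complex) \<Rightarrow> real ^ 2 \<Rightarrow> complex" where
  "fourier_ext f \<xi> =
     (LINT x|arc_measure. exp (- \<i> * complex_of_real (\<xi> \<bullet> x)) * f x)"

definition restriction_const :: ennreal where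
  "restriction_const =
     Sup {Lp_norm 6 lborel (fourier_ext f) | f.
            in_Lp 2 arc_measure f \<and> Lp_norm 2 arc_measure f = 1}"

definition extremizer :: "(real ^ 2 \<Rightarrow> complex) \<Rightarrow> bool" where
  "extremizer f \<longleftrightarrow>
     in_Lp 2 arc_measure f \<and>
     \<not> (AE x in arc_measure. f x = 0) \<and>
     Lp_norm 6 lborel (fourier_ext f) = restriction_const * Lp_norm 2 arc_measure f"

lemma circle_param_in_S1: "circle_param t \<in> S1"
  by (simp add: circle_param_def norm_vec_def L2_set_def sum_2)

lemma measurable_circle_param:
  "circle_param \<in> restrict_space lborel A \<rightarrow>\<^sub>M restrict_space borel S1"
proof -
  have "circle_param = (\<lambda>t. \<chi> i. if i = 1 then cos t else sin t)"
    by (auto simp: circle_param_def vec_eq_iff forall_2)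
  moreover have "continuous_on UNIV (\<lambda>t. (\<chi> i. if i = 1 then cos t else sin t) :: real ^ 2)"
  proof (rule continuous_on_vec_lambda)
    show "continuous_on UNIV (\<lambda>t. if i = 1 then cos t else sin t :: real)" for i :: 2
      by (cases "i = 1") (auto intro!: continuous_intros)
  qed
  ultimately have "continuous_on UNIV circle_param"
    by metis
  then have "circle_param \<in> borel_measurable borel"
    by (rule borel_measurable_continuous_onI)
  then have "circle_param \<in> restrict_space lborel A \<rightarrow>\<^sub>M borel"
    by (intro measurable_restrict_space1) simp
  then show ?thesis
    using circle_param_in_S1 by (intro measurable_restrict_space2) auto
qed

lemma space_arc_measure: "space arc_measure = S1"
  by (simp add: arc_measure_def space_restrict_space)

lemma emeasure_arc_measure_S1: "emeasure arc_measure S1 = ennreal (2 * pi)"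
proof -
  have "circle_param -` S1 = UNIV"
    using circle_param_in_S1 by auto
  moreover have "S1 \<in> sets (restrict_space borel S1)"
    by (simp add: sets_restrict_space_iff)
  ultimately show ?thesis
    by (simp add: arc_measure_def emeasure_distr measurable_circle_param
        space_restrict_space emeasure_restrict_space)
qed

end

theory Submission imports Defs "HOL-Probability.Characteristic_Functions" begin

text \<open>
  Write \<open>E f\<close> for the sixth power of the \<open>L\<^sup>6\<close> norm of the extension of \<open>f\<close>. The proof compares \<open>f\<close>
  with its antipodal mean \<open>s x = sqrt ((\<bar>f x\<bar>\<^sup>2 + \<bar>f (- x)\<bar>\<^sup>2) / 2)\<close>, which has the same \<open>L\<^sup>2\<close> norm, and
  shows that \<open>E\<close> strictly increases unless \<open>\<bar>f\<bar>\<close> is already antipodally symmetric.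

  The cube of the extension of \<open>f\<close> is the Fourier transform of \<open>f \<otimes> f \<otimes> f\<close> on triples of points
  of the circle. Hence, by Plancherel, \<open>E f\<close> is formally the integral of a product of six values of \<open>f\<close>
  (three of them conjugated) against \<open>\<delta> (x1 + x2 + x3 - y1 - y2 - y3)\<close>. Reflecting the \<open>y\<close>'s makes
  the constraint symmetric in all six points, at the price of replacing \<open>\<bar>f\<bar>\<close> by its reflection
  in three slots. Now pair an unreflected slot with a reflected one. The constraint does not change
  when the two points trade places, so \<open>\<bar>f x\<bar> \<bar>f (- y)\<bar>\<close> may be averaged with \<open>\<bar>f (- x)\<bar> \<bar>f y\<bar>\<close>,
  and by Cauchy-Schwarz this average is at most \<open>s x * s y\<close>. It is even at most \<open>s x * s y - u x * u y\<close>,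
  where \<open>u\<close> is \<open>s x - (\<bar>f x\<bar> + \<bar>f (- x)\<bar>) / 2\<close> on the set where \<open>\<bar>f (- x)\<bar> < \<bar>f x\<bar>\<close> and \<open>0\<close> elsewhere
  (\<open>antipodal_pair_bound\<close>). Since \<open>u \<le> s\<close> and \<open>s\<close> is even, multiplying three such bounds gives
  \<open>E f + E u \<le> E s\<close>. For an extremizer \<open>E s \<le> E f\<close>, so \<open>u\<close> vanishes almost everywhere provided that
  \<open>E f\<close> is finite. This says \<open>\<bar>f x\<bar> \<le> \<bar>f (- x)\<bar>\<close> almost everywhere, and the reflection of the same
  inequality finishes the proof.

  To give a meaning to the delta function, \<open>E\<close> is weighted with the Gaussian \<open>exp (- e \<bar>\<xi>\<bar>\<^sup>2 / 2)\<close>, so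
  that \<open>\<delta>\<close> becomes a strictly positive Gaussian and all integrals are instances of Fubini's
  theorem. Strict positivity also makes the term belonging to \<open>u\<close> positive at \<open>e = 1\<close>
  unless \<open>u = 0\<close> (\<open>six_pos\<close>), and this term only grows as \<open>e\<close> decreases to \<open>0\<close>. The six-fold integrals
  are written as iterated correlation operators \<open>conv\<close>, which commute; rearranging the six slots is
  then rewriting. The outcome is \<open>sextic_energy_superadditive\<close>.

  Finiteness of \<open>E f\<close> for \<open>f\<close> in \<open>L\<^sup>2\<close> is the endpoint Tomas-Stein theorem in the plane. By the
  triangle inequality \<open>f\<close> may be assumed to live on a quarter circle. Schur's test then reduces the
  claim to a uniform bound for the smoothed triple self-convolution of arc length at sums of three
  points of that quarter. On the whole circle this convolution has a logarithmic singularity at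
  distance \<open>1\<close> from the origin; sums of three points of a quarter circle stay away from it, and there
  the bound follows from explicit integrations (\<open>arc_kernel_le\<close>).
\<close>

section \<open>Fourier transform of the Gaussian\<close>

lemma (in pair_sigma_finite)
  fixes f :: "'a \<Rightarrow> complex" and g :: "'b \<Rightarrow> complex"
  assumes f: "integrable M1 f" and g: "integrable M2 g"
  shows integrable_prod_mult: "integrable (M1 \<Otimes>\<^sub>M M2) (\<lambda>p. f (fst p) * g (snd p))"
    and integral_prod_mult: "(\<integral>p. f (fst p) * g (snd p) \<partial>(M1 \<Otimes>\<^sub>M M2)) = (\<integral>x. f x \<partial>M1) * (\<integral>y. g y \<partial>M2)"
proof -
  note [measurable] = borel_measurable_integrable[OF f] borel_measurable_integrable[OF g]
  show I: "integrable (M1 \<Otimes>\<^sub>M M2) (\<lambda>p. f (fst p) * g (snd p))"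
  proof (rule Fubini_integrable)
    show "integrable M1 (\<lambda>x. \<integral>y. norm (f (fst (x, y)) * g (snd (x, y))) \<partial>M2)"
      using f by (simp add: norm_mult)
  qed (use g in auto)
  show "(\<integral>p. f (fst p) * g (snd p) \<partial>(M1 \<Otimes>\<^sub>M M2)) = (\<integral>x. f x \<partial>M1) * (\<integral>y. g y \<partial>M2)"
    using integral_fst'[OF I] by simp
qed

definition gauss :: "real \<Rightarrow> 'a::euclidean_space \<Rightarrow> real" where
  "gauss e x = exp (- (e * (norm x)\<^sup>2 / 2))"

text \<open>The Fourier transform of \<open>gauss e\<close>, see \<open>gauss_fourier\<close>.\<close>

definition gauss_hat :: "real \<Rightarrow> 'a::euclidean_space \<Rightarrow> real" where
  "gauss_hat e v = sqrt (2 * pi / e) ^ DIM('a) * exp (- ((norm v)\<^sup>2 / (2 * e)))"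

lemma measurable_gauss [measurable]: "gauss e \<in> borel_measurable borel"
  and measurable_gauss_hat [measurable]: "gauss_hat e \<in> borel_measurable borel"
  unfolding gauss_def gauss_hat_def by measurable

text \<open>A rescaling of the characteristic function of the standard normal distribution.\<close>

lemma gauss_fourier_real:
  assumes e: "e > 0"
  shows "has_bochner_integral lborel
    (\<lambda>x. complex_of_real (exp (- (e * x\<^sup>2 / 2))) * exp (- \<i> * complex_of_real (x * v)))
    (complex_of_real (sqrt (2 * pi / e) * exp (- (v\<^sup>2 / (2 * e)))))"
proof -
  let ?t = "- v / sqrt e"
  have int: "integrable lborel (\<lambda>x. std_normal_density x *\<^sub>R iexp (?t * x))"
    by (rule Bochner_Integration.integrable_bound[OF integrable_normal_density[of 1 0]])
       (auto simp: norm_mult)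
  have "(\<integral>x. std_normal_density x *\<^sub>R iexp (?t * x) \<partial>lborel) = char std_normal_distribution ?t"
    unfolding char_def by (subst integral_density) auto
  also have "\<dots> = complex_of_real (exp (- (v\<^sup>2 / (2 * e))))"
    using e by (simp add: char_std_normal_distribution power_divide divide_simps)
  finally have hb: "has_bochner_integral lborel (\<lambda>x. std_normal_density x *\<^sub>R iexp (?t * x))
      (complex_of_real (exp (- (v\<^sup>2 / (2 * e)))))"
    using int by (simp add: has_bochner_integral_iff)
  let ?f = "\<lambda>x. complex_of_real (exp (- (e * x\<^sup>2 / 2))) * exp (- \<i> * complex_of_real (x * v))"
  have f: "?f (0 + (1 / sqrt e) * x) = sqrt (2 * pi) *\<^sub>R (std_normal_density x *\<^sub>R iexp (?t * x))" for x
  proof -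
    have "e * (x / sqrt e)\<^sup>2 = x\<^sup>2" using e by (simp add: power_divide)
    then show ?thesis
      by (simp add: std_normal_density_def scaleR_conv_of_real field_simps)
  qed
  have "has_bochner_integral lborel ?f (\<bar>1 / sqrt e\<bar> *\<^sub>R (sqrt (2 * pi) *\<^sub>R complex_of_real (exp (- (v\<^sup>2 / (2 * e))))))"
  proof (subst lborel_has_bochner_integral_real_affine_iff[where c = "1 / sqrt e" and t = 0])
    show "1 / sqrt e \<noteq> 0" using e by simp
    have "has_bochner_integral lborel (\<lambda>x. ?f (0 + (1 / sqrt e) * x)) (sqrt (2 * pi) *\<^sub>R complex_of_real (exp (- (v\<^sup>2 / (2 * e)))))"
      unfolding f by (rule has_bochner_integral_scaleR_right) (rule hb)
    then show "has_bochner_integral lborel (\<lambda>x. ?f (0 + (1 / sqrt e) * x)) ((\<bar>1 / sqrt e\<bar> *\<^sub>R (sqrt (2 * pi) *\<^sub>R complex_of_real (exp (- (v\<^sup>2 / (2 * e)))))) /\<^sub>R \<bar>1 / sqrt e\<bar>)"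
      using e by simp
  qed
  then show ?thesis
    using e by (simp add: scaleR_conv_of_real real_sqrt_divide)
qed

text \<open>Gaussian and character both factor over an orthonormal basis, so the integral is a product
  of one-dimensional ones.\<close>

lemma gauss_fourier:
  fixes v :: "'a::euclidean_space"
  assumes e: "e > 0"
  shows "has_bochner_integral lborel
    (\<lambda>x. complex_of_real (gauss e x) * exp (- \<i> * complex_of_real (x \<bullet> v))) (complex_of_real (gauss_hat e v))"
proof -
  interpret product_sigma_finite "\<lambda>_::'a. lborel :: real measure" ..
  define f where "f b x = complex_of_real (exp (- (e * x\<^sup>2 / 2))) * exp (- \<i> * complex_of_real (x * (v \<bullet> b)))"
    for b :: 'a and x :: real
  have fm [measurable]: "f b \<in> borel_measurable borel" for b
    unfolding f_def by measurable
  let ?P = "\<Pi>\<^sub>M b\<in>(Basis::'a set). (lborel::real measure)"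
  let ?h = "\<lambda>x::'a. complex_of_real (gauss e x) * exp (- \<i> * complex_of_real (x \<bullet> v))"
  have h: "?h x = (\<Prod>b\<in>Basis. f b (x \<bullet> b))" for x
  proof -
    have "gauss e x = (\<Prod>b\<in>Basis. exp (- (e * (x \<bullet> b)\<^sup>2 / 2)))"
      unfolding gauss_def power2_norm_eq_inner
      by (subst euclidean_inner)
         (simp add: exp_sum[symmetric] sum_negf sum_divide_distrib sum_distrib_left power2_eq_square)
    moreover have "exp (- \<i> * complex_of_real (x \<bullet> v)) = (\<Prod>b\<in>Basis. exp (- \<i> * complex_of_real ((x \<bullet> b) * (v \<bullet> b))))"
      by (subst euclidean_inner) (simp add: exp_sum[symmetric] sum_negf sum_distrib_left del: of_real_mult)
    ultimately show ?thesis
      by (simp add: f_def prod.distrib)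
  qed
  have hs: "?h (\<Sum>b\<in>Basis. w b *\<^sub>R b) = (\<Prod>b\<in>Basis. f b (w b))" for w
    unfolding h by (intro prod.cong refl) simp
  have fi: "integrable lborel (f b)" "(\<integral>x. f b x \<partial>lborel) = complex_of_real (sqrt (2 * pi / e) * exp (- ((v \<bullet> b)\<^sup>2 / (2 * e))))" for b
    using gauss_fourier_real[OF e, of "v \<bullet> b"] unfolding has_bochner_integral_iff f_def by auto
  have m: "(\<lambda>w. \<Sum>b\<in>Basis. w b *\<^sub>R b) \<in> ?P \<rightarrow>\<^sub>M (borel :: 'a measure)" by measurable
  have hm: "?h \<in> borel_measurable borel" by measurable
  have "integrable (distr ?P borel (\<lambda>w. \<Sum>b\<in>Basis. w b *\<^sub>R b)) ?h"
    by (subst integrable_distr_eq[OF m hm])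
       (unfold hs, intro product_integrable_prod fi finite_Basis)
  moreover have "integral\<^sup>L (distr ?P borel (\<lambda>w. \<Sum>b\<in>Basis. w b *\<^sub>R b)) ?h = (\<Prod>b\<in>Basis. \<integral>x. f b x \<partial>lborel)"
    by (subst integral_distr[OF m hm])
       (unfold hs, intro product_integral_prod fi finite_Basis)
  moreover have "(\<Prod>b\<in>Basis. \<integral>x. f b x \<partial>lborel) = complex_of_real (gauss_hat e v)"
    unfolding fi gauss_hat_def power2_norm_eq_inner
    by (subst euclidean_inner)
       (simp add: prod.distrib exp_sum[symmetric] sum_negf sum_divide_distrib sum_distrib_left power2_eq_square flip: of_real_prod)
  ultimately show ?thesis
    unfolding has_bochner_integral_iff by (subst (1 2) lborel_eq) auto
qed

lemma integrable_gauss: "e > 0 \<Longrightarrow> integrable lborel (gauss e :: 'a::euclidean_space \<Rightarrow> real)"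
  using gauss_fourier[of e "0::'a"] by (simp add: has_bochner_integral_iff complex_of_real_integrable_eq)

section \<open>Gaussian-weighted energies of oscillatory integrals\<close>

text \<open>The Fourier transform of the image under \<open>\<Phi>\<close> of the measure with density \<open>U\<close>. Keeping \<open>\<Phi>\<close>
  separate lets the same lemmas serve arc length (\<open>\<Phi>\<close> the identity), a parameter interval (\<open>\<Phi>\<close> the
  parametrization) and triple products of either (\<open>\<Phi>\<close> the sum of the three points).\<close>

definition osc :: "'b measure \<Rightarrow> ('b \<Rightarrow> 'a::euclidean_space) \<Rightarrow> ('b \<Rightarrow> complex) \<Rightarrow> 'a \<Rightarrow> complex" where
  "osc N \<Phi> U \<xi> = (LINT x|N. exp (- \<i> * complex_of_real (\<xi> \<bullet> \<Phi> x)) * U x)"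

lemma norm_exp_i_neg [simp]: "norm (exp (- (\<i> * complex_of_real r))) = 1"
  using norm_exp_i_times[of "-r"] by simp

lemma measurable_cnj [measurable]: "cnj \<in> borel_measurable borel"
  by (intro borel_measurable_continuous_onI continuous_intros)

lemma integrable_osc:
  fixes \<Phi> :: "'b \<Rightarrow> 'a::euclidean_space"
  assumes [measurable]: "\<Phi> \<in> borel_measurable N" and U: "integrable N U"
  shows "integrable N (\<lambda>x. exp (- \<i> * complex_of_real (\<xi> \<bullet> \<Phi> x)) * U x)"
proof (rule Bochner_Integration.integrable_bound[OF U])
  have [measurable]: "U \<in> borel_measurable N" using U by auto
  show "(\<lambda>x. exp (- \<i> * complex_of_real (\<xi> \<bullet> \<Phi> x)) * U x) \<in> borel_measurable N"
    by measurable
qed (simp add: norm_mult)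

lemma measurable_osc [measurable (raw)]:
  fixes \<Phi> :: "'b \<Rightarrow> 'a::euclidean_space"
  assumes "sigma_finite_measure N"
    and [measurable]: "\<Phi> \<in> borel_measurable N" "U \<in> borel_measurable N"
  shows "osc N \<Phi> U \<in> borel_measurable borel"
proof -
  interpret sigma_finite_measure N by fact
  show ?thesis
    unfolding osc_def by measurable
qed

lemma norm_osc_le:
  assumes "\<Phi> \<in> borel_measurable N" and "integrable N U"
  shows "norm (osc N \<Phi> U \<xi>) \<le> (\<integral>x. norm (U x) \<partial>N)"
  unfolding osc_def
  by (rule order_trans[OF integral_norm_bound]) (simp add: norm_mult)

lemma osc_mult:
  assumes "sigma_finite_measure N" "sigma_finite_measure N'"
    and [measurable]: "\<Phi> \<in> borel_measurable N" "\<Phi>' \<in> borel_measurable N'"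
    and "integrable N U" "integrable N' U'"
  shows "osc N \<Phi> U \<xi> * osc N' \<Phi>' U' \<xi>
     = osc (N \<Otimes>\<^sub>M N') (\<lambda>p. \<Phi> (fst p) + \<Phi>' (snd p)) (\<lambda>p. U (fst p) * U' (snd p)) \<xi>"
proof -
  interpret N: sigma_finite_measure N by fact
  interpret N': sigma_finite_measure N' by fact
  interpret pair_sigma_finite N N' ..
  show ?thesis
    unfolding osc_def
    by (subst integral_prod_mult[OF integrable_osc integrable_osc, symmetric])
       (auto intro!: assms Bochner_Integration.integral_cong
          simp: inner_add_right exp_diff exp_minus ring_distribs divide_inverse)
qed

lemma cnj_osc: "cnj (osc N \<Phi> U \<xi>) = osc N (\<lambda>x. - \<Phi> x) (\<lambda>x. cnj (U x)) \<xi>"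
  unfolding osc_def by (subst Bochner_Integration.integral_cnj[symmetric]) (simp add: exp_cnj)

text \<open>Plancherel with a Gaussian weight: expand the square as an integral over pairs and integrate
  in \<open>\<xi>\<close> first. The weight makes the integrand absolutely integrable, so that Fubini applies.\<close>

lemma gauss_weighted_energy:
  fixes \<Phi> :: "'b \<Rightarrow> 'a::euclidean_space"
  assumes e: "e > 0" and sf: "sigma_finite_measure N"
    and [measurable]: "\<Phi> \<in> borel_measurable N" and U: "integrable N U"
  shows "complex_of_real (\<integral>\<xi>. gauss e \<xi> * (norm (osc N \<Phi> U \<xi>))\<^sup>2 \<partial>lborel)
      = (\<integral>p. gauss_hat e (\<Phi> (fst p) - \<Phi> (snd p)) * (U (fst p) * cnj (U (snd p))) \<partial>(N \<Otimes>\<^sub>M N))" (is ?eq)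
    and "integrable lborel (\<lambda>\<xi>. gauss e \<xi> * (norm (osc N \<Phi> U \<xi>))\<^sup>2)"
    and "integrable (N \<Otimes>\<^sub>M N) (\<lambda>p. gauss_hat e (\<Phi> (fst p) - \<Phi> (snd p)) * (U (fst p) * cnj (U (snd p))))"
proof -
  interpret N: sigma_finite_measure N by fact
  interpret NN: pair_sigma_finite N N ..
  interpret P: sigma_finite_measure "N \<Otimes>\<^sub>M N" by (rule NN.P.sigma_finite_measure_axioms)
  interpret L: pair_sigma_finite "lborel :: 'a measure" "N \<Otimes>\<^sub>M N" ..
  have Um [measurable]: "U \<in> borel_measurable N" using U by auto
  have [measurable]: "osc N \<Phi> U \<in> borel_measurable borel"
    by (rule measurable_osc[OF sf]) auto
  let ?U = "\<lambda>p. U (fst p) * cnj (U (snd p))"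
  let ?D = "\<lambda>p. \<Phi> (fst p) - \<Phi> (snd p)"
  have U2: "integrable (N \<Otimes>\<^sub>M N) ?U"
    by (rule NN.integrable_prod_mult[OF U]) (use U in simp)
  let ?F = "\<lambda>\<xi> p. complex_of_real (gauss e \<xi>) * (exp (- \<i> * complex_of_real (\<xi> \<bullet> ?D p)) * ?U p)"
  have F: "integrable (lborel \<Otimes>\<^sub>M (N \<Otimes>\<^sub>M N)) (\<lambda>q. ?F (fst q) (snd q))"
  proof (rule Bochner_Integration.integrable_bound)
    show "integrable (lborel \<Otimes>\<^sub>M (N \<Otimes>\<^sub>M N)) (\<lambda>q. complex_of_real (gauss e (fst q :: 'a)) * ?U (snd q))"
      by (rule L.integrable_prod_mult[OF _ U2]) (simp add: complex_of_real_integrable_eq integrable_gauss e)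
    show "(\<lambda>q. ?F (fst q) (snd q)) \<in> borel_measurable (lborel \<Otimes>\<^sub>M (N \<Otimes>\<^sub>M N))"
      by measurable
  qed (simp add: norm_mult)
  have sq: "complex_of_real ((norm (osc N \<Phi> U \<xi>))\<^sup>2)
      = (\<integral>p. exp (- \<i> * complex_of_real (\<xi> \<bullet> ?D p)) * ?U p \<partial>(N \<Otimes>\<^sub>M N))" for \<xi>
  proof -
    have "complex_of_real ((norm (osc N \<Phi> U \<xi>))\<^sup>2) = osc N \<Phi> U \<xi> * cnj (osc N \<Phi> U \<xi>)"
      by (rule complex_norm_square)
    also have "\<dots> = osc (N \<Otimes>\<^sub>M N) (\<lambda>p. \<Phi> (fst p) + - \<Phi> (snd p)) ?U \<xi>"
      unfolding cnj_osc by (rule osc_mult[OF sf sf]) (use U in auto)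
    finally show ?thesis by (simp add: osc_def)
  qed
  show ?eq
  proof -
    have "complex_of_real (\<integral>\<xi>. gauss e \<xi> * (norm (osc N \<Phi> U \<xi>))\<^sup>2 \<partial>lborel)
        = (\<integral>\<xi>. (\<integral>p. ?F \<xi> p \<partial>(N \<Otimes>\<^sub>M N)) \<partial>lborel)"
      by (subst integral_complex_of_real[symmetric]) (simp add: sq del: of_real_power)
    also have "\<dots> = (\<integral>p. (\<integral>\<xi>. ?F \<xi> p \<partial>lborel) \<partial>(N \<Otimes>\<^sub>M N))"
      by (rule L.Fubini_integral[symmetric]) (use F in \<open>simp add: case_prod_unfold\<close>)
    also have "\<dots> = (\<integral>p. gauss_hat e (?D p) * ?U p \<partial>(N \<Otimes>\<^sub>M N))"
      by (simp add: has_bochner_integral_integral_eq[OF gauss_fourier[OF e], simplified] flip: mult.assoc)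
    finally show ?thesis .
  qed
  show "integrable (N \<Otimes>\<^sub>M N) (\<lambda>p. gauss_hat e (?D p) * ?U p)"
  proof (rule Bochner_Integration.integrable_bound[OF integrable_mult_right[OF U2, of "sqrt (2 * pi / e) ^ DIM('a)"]])
    show "AE p in N \<Otimes>\<^sub>M N. norm (complex_of_real (gauss_hat e (?D p)) * ?U p)
        \<le> norm (complex_of_real (sqrt (2 * pi / e) ^ DIM('a)) * ?U p)"
      using e by (intro AE_I2) (auto simp: gauss_hat_def norm_mult norm_power intro!: mult_right_mono mult_left_le_one_le)
  qed auto
  show "integrable lborel (\<lambda>\<xi>. gauss e \<xi> * (norm (osc N \<Phi> U \<xi>))\<^sup>2)"
  proof (rule Bochner_Integration.integrable_bound[OF integrable_mult_left[OF integrable_gauss[OF e], of "(\<integral>x. norm (U x) \<partial>N)\<^sup>2"]])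
    show "AE \<xi> in lborel. norm (gauss e \<xi> * (norm (osc N \<Phi> U \<xi>))\<^sup>2) \<le> norm (gauss e \<xi> * (\<integral>x. norm (U x) \<partial>N)\<^sup>2)"
      using norm_osc_le[OF _ U, of \<Phi>]
      by (intro AE_I2) (auto simp: abs_mult gauss_def intro!: mult_left_mono power_mono)
  qed auto
qed

lemma gauss_hat_nonneg: "e > 0 \<Longrightarrow> gauss_hat e v \<ge> 0"
  by (simp add: gauss_hat_def)

text \<open>Because \<open>gauss_hat\<close> is positive, replacing \<open>U\<close> by its modulus can only increase the energy;
  nothing is lost when \<open>U\<close> is nonnegative already.\<close>

lemma gauss_weighted_energy_le:
  fixes \<Phi> :: "'b \<Rightarrow> 'a::euclidean_space"
  assumes e: "e > 0" and sf: "sigma_finite_measure N"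
    and m: "\<Phi> \<in> borel_measurable N" and U: "integrable N U"
  shows "(\<integral>\<^sup>+\<xi>. ennreal (gauss e \<xi> * (norm (osc N \<Phi> U \<xi>))\<^sup>2) \<partial>lborel)
      \<le> (\<integral>\<^sup>+p. ennreal (gauss_hat e (\<Phi> (fst p) - \<Phi> (snd p)) * (norm (U (fst p)) * norm (U (snd p)))) \<partial>(N \<Otimes>\<^sub>M N))"
proof -
  note w = gauss_weighted_energy[OF e sf m U]
  have "(\<integral>\<^sup>+\<xi>. ennreal (gauss e \<xi> * (norm (osc N \<Phi> U \<xi>))\<^sup>2) \<partial>lborel)
     = ennreal (\<integral>\<xi>. gauss e \<xi> * (norm (osc N \<Phi> U \<xi>))\<^sup>2 \<partial>lborel)"
    by (rule nn_integral_eq_integral[OF w(2)]) (simp add: gauss_def)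
  also have "\<dots> \<le> ennreal (norm (complex_of_real (\<integral>\<xi>. gauss e \<xi> * (norm (osc N \<Phi> U \<xi>))\<^sup>2 \<partial>lborel)))"
    by (intro ennreal_leI) simp
  also have "\<dots> \<le> (\<integral>\<^sup>+p. ennreal (norm (gauss_hat e (\<Phi> (fst p) - \<Phi> (snd p)) * (U (fst p) * cnj (U (snd p))))) \<partial>(N \<Otimes>\<^sub>M N))"
    unfolding w(1) by (rule integral_norm_bound_ennreal[OF w(3)])
  finally show ?thesis
    using e by (simp add: norm_mult gauss_hat_nonneg)
qed

lemma gauss_weighted_energy_eq:
  fixes \<Phi> :: "'b \<Rightarrow> 'a::euclidean_space"
  assumes e: "e > 0" and sf: "sigma_finite_measure N"
    and m: "\<Phi> \<in> borel_measurable N" and U: "integrable N (\<lambda>x. complex_of_real (g x))" and g: "\<And>x. g x \<ge> 0"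
  shows "(\<integral>\<^sup>+\<xi>. ennreal (gauss e \<xi> * (norm (osc N \<Phi> (\<lambda>x. complex_of_real (g x)) \<xi>))\<^sup>2) \<partial>lborel)
      = (\<integral>\<^sup>+p. ennreal (gauss_hat e (\<Phi> (fst p) - \<Phi> (snd p)) * (g (fst p) * g (snd p))) \<partial>(N \<Otimes>\<^sub>M N))"
proof -
  note w = gauss_weighted_energy[OF e sf m U]
  let ?K = "\<lambda>p. gauss_hat e (\<Phi> (fst p) - \<Phi> (snd p)) * (g (fst p) * g (snd p))"
  have K: "integrable (N \<Otimes>\<^sub>M N) ?K"
    using w(3) by (simp flip: of_real_mult add: complex_of_real_integrable_eq)
  have "(\<integral>\<xi>. gauss e \<xi> * (norm (osc N \<Phi> (\<lambda>x. complex_of_real (g x)) \<xi>))\<^sup>2 \<partial>lborel) = (\<integral>p. ?K p \<partial>(N \<Otimes>\<^sub>M N))"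
    using w(1) by (simp flip: of_real_mult)
  then show ?thesis
    using nn_integral_eq_integral[OF w(2)] nn_integral_eq_integral[OF K] g e
    by (simp add: gauss_hat_nonneg gauss_def)
qed

definition sum3 :: "('b \<Rightarrow> 'a::ab_semigroup_add) \<Rightarrow> 'b \<times> 'b \<times> 'b \<Rightarrow> 'a" where
  "sum3 \<Phi> p = \<Phi> (fst p) + (\<Phi> (fst (snd p)) + \<Phi> (snd (snd p)))"

definition prod3 :: "('b \<Rightarrow> 'a::ab_semigroup_mult) \<Rightarrow> 'b \<times> 'b \<times> 'b \<Rightarrow> 'a" where
  "prod3 U p = U (fst p) * (U (fst (snd p)) * U (snd (snd p)))"

abbreviation cube_measure :: "'b measure \<Rightarrow> ('b \<times> 'b \<times> 'b) measure" where
  "cube_measure N \<equiv> N \<Otimes>\<^sub>M (N \<Otimes>\<^sub>M N)"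

lemma measurable_sum3 [measurable (raw)]:
  fixes \<Phi> :: "'b \<Rightarrow> 'a::euclidean_space"
  assumes [measurable]: "\<Phi> \<in> borel_measurable N"
  shows "sum3 \<Phi> \<in> borel_measurable (cube_measure N)"
  unfolding sum3_def[abs_def] by measurable

lemma measurable_prod3_ennreal:
  fixes U :: "'b \<Rightarrow> ennreal"
  assumes [measurable]: "U \<in> borel_measurable N"
  shows "prod3 U \<in> borel_measurable (cube_measure N)"
  unfolding prod3_def[abs_def] by measurable

lemma sigma_finite_pair:
  assumes "sigma_finite_measure N" "sigma_finite_measure N'"
  shows "sigma_finite_measure (N \<Otimes>\<^sub>M N')"
proof -
  interpret N: sigma_finite_measure N by fact
  interpret N': sigma_finite_measure N' by fact
  interpret pair_sigma_finite N N' ..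
  show ?thesis by (rule P.sigma_finite_measure_axioms)
qed

lemma integrable_prod3:
  fixes U :: "'b \<Rightarrow> complex"
  assumes sf: "sigma_finite_measure N" and U: "integrable N U"
  shows "integrable (cube_measure N) (prod3 U)"
proof -
  interpret N: sigma_finite_measure N by fact
  interpret NN: pair_sigma_finite N N ..
  interpret P: sigma_finite_measure "N \<Otimes>\<^sub>M N" by (rule sigma_finite_pair[OF sf sf])
  interpret PN: pair_sigma_finite N "N \<Otimes>\<^sub>M N" ..
  show ?thesis
    unfolding prod3_def[abs_def]
    by (rule PN.integrable_prod_mult[OF U NN.integrable_prod_mult[OF U U]])
qed

text \<open>This turns a sixth moment into a second moment over triples.\<close>

lemma osc_cube:
  fixes \<Phi> :: "'b \<Rightarrow> 'a::euclidean_space"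
  assumes sf: "sigma_finite_measure N" and [measurable]: "\<Phi> \<in> borel_measurable N" and U: "integrable N U"
  shows "osc N \<Phi> U \<xi> ^ 3 = osc (cube_measure N) (sum3 \<Phi>) (prod3 U) \<xi>"
proof -
  interpret N: sigma_finite_measure N by fact
  interpret NN: pair_sigma_finite N N ..
  have "osc N \<Phi> U \<xi> ^ 3 = osc N \<Phi> U \<xi> * (osc N \<Phi> U \<xi> * osc N \<Phi> U \<xi>)"
    by (simp add: power3_eq_cube)
  also have "osc N \<Phi> U \<xi> * osc N \<Phi> U \<xi>
      = osc (N \<Otimes>\<^sub>M N) (\<lambda>p. \<Phi> (fst p) + \<Phi> (snd p)) (\<lambda>p. U (fst p) * U (snd p)) \<xi>"
    by (rule osc_mult) (use assms in auto)
  also have "osc N \<Phi> U \<xi> * \<dots> = osc (cube_measure N) (sum3 \<Phi>) (prod3 U) \<xi>"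
    unfolding sum3_def[abs_def] prod3_def[abs_def]
    by (rule osc_mult[OF sf sigma_finite_pair[OF sf sf] _ _ U NN.integrable_prod_mult[OF U U]]) measurable
  finally show ?thesis .
qed

lemma gauss_weighted_sextic_le:
  fixes \<Phi> :: "'b \<Rightarrow> 'a::euclidean_space"
  assumes e: "e > 0" and sf: "sigma_finite_measure N"
    and [measurable]: "\<Phi> \<in> borel_measurable N" and U: "integrable N U"
  shows "(\<integral>\<^sup>+\<xi>. ennreal (gauss e \<xi> * (norm (osc N \<Phi> U \<xi>)) ^ 6) \<partial>lborel)
      \<le> (\<integral>\<^sup>+p. ennreal (gauss_hat e (sum3 \<Phi> (fst p) - sum3 \<Phi> (snd p)))
          * (prod3 (\<lambda>x. ennreal (norm (U x))) (fst p) * prod3 (\<lambda>x. ennreal (norm (U x))) (snd p))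
          \<partial>(cube_measure N \<Otimes>\<^sub>M cube_measure N))"
proof -
  have 6: "norm (osc N \<Phi> U \<xi>) ^ 6 = (norm (osc (cube_measure N) (sum3 \<Phi>) (prod3 U) \<xi>))\<^sup>2" for \<xi>
    by (simp add: osc_cube[OF sf _ U, symmetric] norm_power flip: power_mult)
  show ?thesis
    unfolding 6
    by (rule order_trans[OF gauss_weighted_energy_le[OF e _ _ integrable_prod3[OF sf U]]])
       (auto simp: prod3_def norm_mult ennreal_mult gauss_hat_nonneg e intro!: sigma_finite_pair sf)
qed

lemma gauss_weighted_sextic_eq:
  fixes \<Phi> :: "'b \<Rightarrow> 'a::euclidean_space" and g :: "'b \<Rightarrow> real"
  assumes e: "e > 0" and sf: "sigma_finite_measure N"
    and [measurable]: "\<Phi> \<in> borel_measurable N" and U: "integrable N g" and g: "\<And>x. g x \<ge> 0"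
  shows "(\<integral>\<^sup>+\<xi>. ennreal (gauss e \<xi> * (norm (osc N \<Phi> (\<lambda>x. complex_of_real (g x)) \<xi>)) ^ 6) \<partial>lborel)
      = (\<integral>\<^sup>+p. ennreal (gauss_hat e (sum3 \<Phi> (fst p) - sum3 \<Phi> (snd p)))
          * (prod3 (\<lambda>x. ennreal (g x)) (fst p) * prod3 (\<lambda>x. ennreal (g x)) (snd p))
          \<partial>(cube_measure N \<Otimes>\<^sub>M cube_measure N))"
proof -
  let ?U = "\<lambda>x. complex_of_real (g x)"
  have Uc: "integrable N ?U" using U by (simp add: complex_of_real_integrable_eq)
  have p: "prod3 ?U = (\<lambda>p. complex_of_real (prod3 g p))"
    by (simp add: prod3_def fun_eq_iff)
  have 6: "norm (osc N \<Phi> ?U \<xi>) ^ 6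
     = (norm (osc (cube_measure N) (sum3 \<Phi>) (\<lambda>p. complex_of_real (prod3 g p)) \<xi>))\<^sup>2" for \<xi>
    by (simp add: osc_cube[OF sf _ Uc, symmetric] norm_power p[symmetric] flip: power_mult)
  have I: "integrable (cube_measure N) (\<lambda>p. complex_of_real (prod3 g p))"
    using integrable_prod3[OF sf Uc] unfolding p .
  show ?thesis
    unfolding 6
    by (subst gauss_weighted_energy_eq[OF e _ _ I])
       (auto simp: prod3_def ennreal_mult gauss_hat_nonneg e g intro!: sigma_finite_pair sf)
qed

lemma nn_integral_cube:
  assumes sf: "sigma_finite_measure N" and [measurable]: "F \<in> borel_measurable (cube_measure N)"
  shows "(\<integral>\<^sup>+p. F p \<partial>cube_measure N) = (\<integral>\<^sup>+x. \<integral>\<^sup>+y. \<integral>\<^sup>+z. F (x, y, z) \<partial>N \<partial>N \<partial>N)"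
proof -
  interpret N: sigma_finite_measure N by fact
  interpret P: sigma_finite_measure "N \<Otimes>\<^sub>M N" by (rule sigma_finite_pair[OF sf sf])
  have "(\<integral>\<^sup>+p. F p \<partial>cube_measure N) = (\<integral>\<^sup>+x. \<integral>\<^sup>+q. F (x, q) \<partial>(N \<Otimes>\<^sub>M N) \<partial>N)"
    by (rule P.nn_integral_fst[symmetric]) simp
  also have "\<dots> = (\<integral>\<^sup>+x. \<integral>\<^sup>+y. \<integral>\<^sup>+z. F (x, y, z) \<partial>N \<partial>N \<partial>N)"
    by (intro nn_integral_cong N.nn_integral_fst[symmetric]) simp
  finally show ?thesis .
qed

section \<open>Correlation operators\<close>

text \<open>Correlation of \<open>k\<close> with the measure of density \<open>h\<close>. Six-fold integrals of
  \<open>k (x1 + ... + x6)\<close> against a product density are compositions of six such operators at \<open>0\<close>. Values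
  are extended nonnegative reals, so no integrability conditions arise.\<close>

definition conv :: "'a measure \<Rightarrow> ('a \<Rightarrow> ennreal) \<Rightarrow> ('a::euclidean_space \<Rightarrow> ennreal) \<Rightarrow> 'a \<Rightarrow> ennreal" where
  "conv N h k v = (\<integral>\<^sup>+x. h x * k (v + x) \<partial>N)"

lemma conv_mono: "(\<And>x. h x \<le> h' x) \<Longrightarrow> (\<And>x. k x \<le> k' x) \<Longrightarrow> conv N h k v \<le> conv N h' k' v"
  unfolding conv_def by (intro nn_integral_mono mult_mono) auto

locale translating_measure = sigma_finite_measure N for N :: "'a::euclidean_space measure" +
  assumes ident [measurable]: "(\<lambda>x. x) \<in> borel_measurable N"
begin

lemma measurable_conv [measurable (raw)]:
  assumes [measurable]: "h \<in> borel_measurable N" "k \<in> borel_measurable borel"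
  shows "conv N h k \<in> borel_measurable borel"
  unfolding conv_def[abs_def] by measurable

lemma conv_conv:
  assumes [measurable]: "h \<in> borel_measurable N" "h' \<in> borel_measurable N" "k \<in> borel_measurable borel"
  shows "conv N h (conv N h' k) v = (\<integral>\<^sup>+x. \<integral>\<^sup>+y. (h x * h' y) * k (v + x + y) \<partial>N \<partial>N)"
  unfolding conv_def by (simp add: nn_integral_cmult[symmetric] mult.assoc)

text \<open>Tonelli's theorem in operator form. It permutes the slots of a six-fold integral.\<close>

lemma conv_commute:
  assumes [measurable]: "h \<in> borel_measurable N" "h' \<in> borel_measurable N" "k \<in> borel_measurable borel"
  shows "conv N h (conv N h' k) = conv N h' (conv N h k)"
proof
  fix v
  interpret pair_sigma_finite N N ..
  have "conv N h (conv N h' k) v = (\<integral>\<^sup>+y. \<integral>\<^sup>+x. (h x * h' y) * k (v + x + y) \<partial>N \<partial>N)"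
    unfolding conv_conv[OF assms] by (rule Fubini'[symmetric]) measurable
  also have "\<dots> = conv N h' (conv N h k) v"
    unfolding conv_conv[OF assms(2,1,3)] by (simp add: mult_ac add_ac)
  finally show "conv N h (conv N h' k) v = conv N h' (conv N h k) v" .
qed

lemma nn_integral_cube_conv:
  assumes [measurable]: "h \<in> borel_measurable N" "k \<in> borel_measurable borel"
  shows "(\<integral>\<^sup>+p. prod3 h p * k (v + sum3 (\<lambda>x. x) p) \<partial>cube_measure N) = conv N h (conv N h (conv N h k)) v"
proof -
  have [measurable]: "prod3 h \<in> borel_measurable (cube_measure N)"
    by (rule measurable_prod3_ennreal) measurable
  have [measurable]: "sum3 (\<lambda>x. x) \<in> borel_measurable (cube_measure N)"
    by (rule measurable_sum3) measurable
  have "(\<integral>\<^sup>+p. prod3 h p * k (v + sum3 (\<lambda>x. x) p) \<partial>cube_measure N)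
     = (\<integral>\<^sup>+x. \<integral>\<^sup>+y. \<integral>\<^sup>+z. h x * (h y * (h z * k (v + x + y + z))) \<partial>N \<partial>N \<partial>N)"
    by (subst nn_integral_cube) (auto simp: sigma_finite_measure_axioms prod3_def sum3_def mult_ac add_ac)
  then show ?thesis
    unfolding conv_def by (simp add: nn_integral_cmult)
qed

end

locale symmetric_measure = translating_measure +
  assumes uminus_measurable [measurable]: "uminus \<in> N \<rightarrow>\<^sub>M N"
    and nn_integral_uminus: "\<And>F. F \<in> borel_measurable N \<Longrightarrow> (\<integral>\<^sup>+x. F (- x) \<partial>N) = (\<integral>\<^sup>+x. F x \<partial>N)"
begin

text \<open>Three factors carry \<open>h\<close> and three its reflection: the latter stem from the conjugated
  factors in the square of the modulus, after \<open>x1 + x2 + x3 - y1 - y2 - y3\<close> has been turned into a plain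
  sum by reflecting the \<open>y\<close>'s.\<close>

abbreviation "six h k \<equiv> conv N h (conv N h (conv N h
   (conv N (\<lambda>x. h (- x)) (conv N (\<lambda>x. h (- x)) (conv N (\<lambda>x. h (- x)) k)))))"

lemma conv_uminus:
  assumes [measurable]: "h \<in> borel_measurable N" "k \<in> borel_measurable borel"
  shows "conv N (\<lambda>x. h (- x)) k v = conv N h (\<lambda>w. k (- w)) (- v)"
  unfolding conv_def
  by (subst nn_integral_uminus[symmetric]) (auto simp: algebra_simps)

lemma nn_integral_cube_cube:
  assumes [measurable]: "h \<in> borel_measurable N" "k \<in> borel_measurable borel"
  shows "(\<integral>\<^sup>+p. k (sum3 (\<lambda>x. x) (fst p) - sum3 (\<lambda>x. x) (snd p)) * (prod3 h (fst p) * prod3 h (snd p))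
      \<partial>(cube_measure N \<Otimes>\<^sub>M cube_measure N)) = six h k 0"
proof -
  let ?h = "\<lambda>x. h (- x)"
  interpret C: sigma_finite_measure "cube_measure N"
    by (intro sigma_finite_pair sigma_finite_measure_axioms)
  have [measurable]: "prod3 h \<in> borel_measurable (cube_measure N)"
    by (rule measurable_prod3_ennreal) measurable
  have [measurable]: "sum3 (\<lambda>x. x) \<in> borel_measurable (cube_measure N)"
    by (rule measurable_sum3) measurable
  have m: "conv N ?h (conv N ?h (conv N ?h k)) v = conv N h (conv N h (conv N h (\<lambda>w. k (- w)))) (- v)" for v
    by (simp add: conv_uminus)
  have "(\<integral>\<^sup>+p. k (sum3 (\<lambda>x. x) (fst p) - sum3 (\<lambda>x. x) (snd p)) * (prod3 h (fst p) * prod3 h (snd p))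
      \<partial>(cube_measure N \<Otimes>\<^sub>M cube_measure N))
     = (\<integral>\<^sup>+p. prod3 h p * (\<integral>\<^sup>+q. prod3 h q * k (- (- sum3 (\<lambda>x. x) p + sum3 (\<lambda>x. x) q)) \<partial>cube_measure N) \<partial>cube_measure N)"
    by (subst C.nn_integral_fst[symmetric], measurable)
       (simp add: nn_integral_cmult[symmetric] mult_ac)
  also have "\<dots> = (\<integral>\<^sup>+p. prod3 h p * conv N ?h (conv N ?h (conv N ?h k)) (0 + sum3 (\<lambda>x. x) p) \<partial>cube_measure N)"
    by (subst nn_integral_cube_conv) (auto simp: m)
  also have "\<dots> = six h k 0"
    by (rule nn_integral_cube_conv) auto
  finally show ?thesis .
qed

end

section \<open>Antipodal symmetrization\<close>

definition antipodal_mean :: "('a::euclidean_space \<Rightarrow> real) \<Rightarrow> 'a \<Rightarrow> real" where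
  "antipodal_mean g x = sqrt (((g x)\<^sup>2 + (g (- x))\<^sup>2) / 2)"

text \<open>How far the quadratic mean of \<open>g x\<close> and \<open>g (- x)\<close> exceeds their arithmetic mean, restricted to
  one side of each antipodal pair. Without the restriction \<open>antipodal_pair_bound\<close> fails: for \<open>y = - x\<close> its
  first two terms already attain the right-hand side.\<close>

definition antipodal_excess :: "('a::euclidean_space \<Rightarrow> real) \<Rightarrow> 'a \<Rightarrow> real" where
  "antipodal_excess g x = (if g (- x) < g x then antipodal_mean g x - (g x + g (- x)) / 2 else 0)"

lemma antipodal_mean_minus [simp]: "antipodal_mean g (- x) = antipodal_mean g x"
  by (simp add: antipodal_mean_def add.commute)

lemma antipodal_mean_nonneg [simp]: "0 \<le> antipodal_mean g x"
  by (simp add: antipodal_mean_def)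

lemma mean_le_antipodal_mean:
  "(g x + g (- x)) / 2 \<le> antipodal_mean g x"
  and mean_less_antipodal_mean:
  "g x \<noteq> g (- x) \<Longrightarrow> (g x + g (- x)) / 2 < antipodal_mean g x"
proof -
  have *: "((g x + g (- x)) / 2)\<^sup>2 = ((g x)\<^sup>2 + (g (- x))\<^sup>2) / 2 - ((g x - g (- x)) / 2)\<^sup>2"
    by (simp add: power2_eq_square field_simps)
  then show "(g x + g (- x)) / 2 \<le> antipodal_mean g x"
    unfolding antipodal_mean_def
    by (intro real_le_rsqrt) (use zero_le_power2[of "(g x - g (- x)) / 2"] in linarith)
  assume "g x \<noteq> g (- x)"
  then have "0 < ((g x - g (- x)) / 2)\<^sup>2"
    by simp
  with * show "(g x + g (- x)) / 2 < antipodal_mean g x"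
    unfolding antipodal_mean_def by (intro real_less_rsqrt) linarith
qed

lemma antipodal_excess_nonneg [simp]: "0 \<le> antipodal_excess g x"
  using mean_le_antipodal_mean[of g x] by (simp add: antipodal_excess_def)

lemma antipodal_excess_le:
  assumes "\<And>x. 0 \<le> g x"
  shows "antipodal_excess g x \<le> antipodal_mean g x"
  using assms[of x] assms[of "-x"] by (simp add: antipodal_excess_def)

text \<open>Where the excess vanishes at \<open>x\<close> or at \<open>y\<close> this is the Cauchy-Schwarz inequality. Otherwise
  \<open>g (- x) < g x\<close> and \<open>g (- y) < g y\<close>, the two pairs are oppositely sorted in the mixed sum, and
  Chebyshev's sum inequality bounds that sum by \<open>2 * (m x * m y)\<close> with the arithmetic means \<open>m\<close>; the gap
  between \<open>m x * m y\<close> and the product of the quadratic means is at least the product of the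
  excesses.\<close>

lemma antipodal_pair_bound:
  assumes "\<And>x. 0 \<le> g x"
  shows "g x * g (- y) + g (- x) * g y + 2 * (antipodal_excess g x * antipodal_excess g y)
     \<le> 2 * (antipodal_mean g x * antipodal_mean g y)"
proof (cases "g (- x) < g x \<and> g (- y) < g y")
  case True
  define m where "m x = (g x + g (- x)) / 2" for x
  have "0 \<le> (g x - g (- x)) * (g y - g (- y))"
    using True by (intro mult_nonneg_nonneg) auto
  then have 1: "g x * g (- y) + g (- x) * g y \<le> 2 * (m x * m y)"
    unfolding m_def by (simp add: field_simps)
  have 2: "0 \<le> (antipodal_mean g x - m x) * m y + m x * (antipodal_mean g y - m y)"
    using mean_le_antipodal_mean[of g x] mean_le_antipodal_mean[of g y] assms
    unfolding m_def by (intro add_nonneg_nonneg mult_nonneg_nonneg) auto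
  have 3: "antipodal_excess g x = antipodal_mean g x - m x" "antipodal_excess g y = antipodal_mean g y - m y"
    using True by (auto simp: antipodal_excess_def m_def)
  show ?thesis
    using 1 2 unfolding 3 by (simp add: algebra_simps)
next
  case False
  have "g x * g (- y) + g (- x) * g y \<le> sqrt (((g x)\<^sup>2 + (g (- x))\<^sup>2) * ((g y)\<^sup>2 + (g (- y))\<^sup>2))"
  proof (rule real_le_rsqrt)
    have "((g x)\<^sup>2 + (g (- x))\<^sup>2) * ((g y)\<^sup>2 + (g (- y))\<^sup>2) - (g x * g (- y) + g (- x) * g y)\<^sup>2
        = (g x * g y - g (- x) * g (- y))\<^sup>2"
      by (simp add: power2_eq_square algebra_simps)
    then show "(g x * g (- y) + g (- x) * g y)\<^sup>2 \<le> ((g x)\<^sup>2 + (g (- x))\<^sup>2) * ((g y)\<^sup>2 + (g (- y))\<^sup>2)"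
      by (smt (verit) zero_le_power2)
  qed
  also have "\<dots> = 2 * (antipodal_mean g x * antipodal_mean g y)"
    by (simp add: antipodal_mean_def real_sqrt_mult[symmetric] real_sqrt_divide)
  finally show ?thesis
    using False by (auto simp: antipodal_excess_def)
qed

context symmetric_measure
begin

text \<open>Since the two operators commute, \<open>g x * g (- y)\<close> may be symmetrized in \<open>x\<close> and \<open>y\<close> before
  \<open>antipodal_pair_bound\<close> is applied under the integral.\<close>

lemma conv_pair_superadditive:
  assumes [measurable]: "g \<in> borel_measurable N" "k \<in> borel_measurable borel" and g: "\<And>x. 0 \<le> g x"
  shows "conv N g (conv N (\<lambda>x. g (- x)) k) v + conv N (antipodal_excess g) (conv N (antipodal_excess g) k) v
    \<le> conv N (antipodal_mean g) (conv N (antipodal_mean g) k) v"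
proof -
  let ?s = "antipodal_mean g" and ?u = "antipodal_excess g" and ?g' = "\<lambda>x. g (- x)"
  have [measurable]: "?s \<in> borel_measurable N"
    unfolding antipodal_mean_def[abs_def] by measurable
  have [measurable]: "?u \<in> borel_measurable N"
    unfolding antipodal_excess_def[abs_def] by measurable
  let ?I = "\<lambda>h h'. conv N (\<lambda>x. ennreal (h x)) (conv N (\<lambda>x. ennreal (h' x)) k) v"
  have "2 * (?I g ?g' + ?I ?u ?u) = ?I g ?g' + ?I ?g' g + 2 * ?I ?u ?u"
    by (subst (3) conv_commute) (auto simp: distrib_left mult_2)
  also have "\<dots> = (\<integral>\<^sup>+x. \<integral>\<^sup>+y. (ennreal (g x) * ennreal (g (- y)) + ennreal (g (- x)) * ennreal (g y)
      + 2 * (ennreal (?u x) * ennreal (?u y))) * k (v + x + y) \<partial>N \<partial>N)"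
    by (subst (1 2 3) conv_conv) (auto simp: nn_integral_add nn_integral_cmult distrib_right mult.assoc)
  also have "\<dots> \<le> (\<integral>\<^sup>+x. \<integral>\<^sup>+y. (2 * (ennreal (?s x) * ennreal (?s y))) * k (v + x + y) \<partial>N \<partial>N)"
  proof (intro nn_integral_mono mult_right_mono)
    fix x y
    have "ennreal (g x * g (- y) + g (- x) * g y + 2 * (?u x * ?u y)) \<le> ennreal (2 * (?s x * ?s y))"
      by (intro ennreal_leI antipodal_pair_bound g)
    then show "ennreal (g x) * ennreal (g (- y)) + ennreal (g (- x)) * ennreal (g y)
        + 2 * (ennreal (?u x) * ennreal (?u y)) \<le> 2 * (ennreal (?s x) * ennreal (?s y))"
      using g by (simp add: ennreal_mult ennreal_plus)
  qed simp
  also have "\<dots> = 2 * ?I ?s ?s"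
    by (subst conv_conv) (auto simp: nn_integral_cmult mult.assoc)
  finally show ?thesis
    by (subst (asm) ennreal_mult_le_mult_iff) auto
qed

text \<open>The six slots are grouped into three pairs consisting of \<open>g\<close> and its reflection. The first pair is
  estimated with the gain from \<open>conv_pair_superadditive\<close>, the other two without. In the gain term the four
  remaining slots carry the antipodal mean, which dominates both the excess and its reflection; lowering
  three of them to the reflected excess and one to the excess leaves \<open>six (antipodal_excess g) k v\<close>.\<close>

lemma six_superadditive:
  assumes [measurable]: "g \<in> borel_measurable N" "k \<in> borel_measurable borel" and g: "\<And>x. 0 \<le> g x"
  shows "six g k v + six (antipodal_excess g) k v \<le> six (antipodal_mean g) k v"
proof -
  let ?S = "conv N (antipodal_mean g)" and ?U = "conv N (antipodal_excess g)"
    and ?U' = "conv N (\<lambda>x. antipodal_excess g (- x))"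
    and ?G = "conv N g" and ?G' = "conv N (\<lambda>x. g (- x))"
  have [measurable]: "antipodal_mean g \<in> borel_measurable N"
    unfolding antipodal_mean_def[abs_def] by measurable
  have [measurable]: "antipodal_excess g \<in> borel_measurable N"
    unfolding antipodal_excess_def[abs_def] by measurable
  have le: "?G (?G' k') w \<le> ?S (?S k') w" if [measurable]: "k' \<in> borel_measurable borel" for k' w
    using conv_pair_superadditive[of g k' w] g by (auto intro: order_trans[rotated])
  have US: "antipodal_excess g x \<le> antipodal_mean g x" "antipodal_excess g (- x) \<le> antipodal_mean g x" for x
    using antipodal_excess_le[of g x] antipodal_excess_le[of g "-x"] g by auto
  have "six g k v = ?G (?G' (?G (?G' (?G (?G' k))))) v"
    by (simp add: conv_commute[of "\<lambda>x. ennreal (g (- x))" "\<lambda>x. ennreal (g x)"])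
  also have "\<dots> \<le> ?G (?G' (?S (?S (?S (?S k))))) v"
    by (intro conv_mono order_refl order_trans[OF _ le]) auto
  finally have 1: "six g k v \<le> ?G (?G' (?S (?S (?S (?S k))))) v" .
  have 2: "six (antipodal_excess g) k v \<le> ?U (?U (?S (?S (?S (?S k))))) v"
    by (intro conv_mono order_refl ennreal_leI US)
  have "?G (?G' (?S (?S (?S (?S k))))) v + ?U (?U (?S (?S (?S (?S k))))) v \<le> ?S (?S (?S (?S (?S (?S k))))) v"
    by (rule conv_pair_superadditive) (use g in auto)
  with add_mono[OF 1 2] show ?thesis
    by (auto intro: order_trans)
qed

lemma conv_pos:
  assumes [measurable]: "h \<in> borel_measurable N" "k \<in> borel_measurable borel"
    and h: "\<not> (AE x in N. h x = 0)" and k: "\<And>x. k x > 0"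
  shows "conv N h k v > 0"
proof (rule ccontr)
  assume "\<not> conv N h k v > 0"
  then have "AE x in N. h x * k (v + x) = 0"
    by (simp add: conv_def nn_integral_0_iff_AE)
  then have "AE x in N. h x = 0"
    using k by (simp add: less_le)
  with h show False by simp
qed

lemma AE_uminus:
  assumes [measurable]: "Measurable.pred N P"
  shows "(AE x in N. P (- x)) \<longleftrightarrow> (AE x in N. P x)"
proof -
  have "(AE x in N. Q x) \<longleftrightarrow> (\<integral>\<^sup>+x. (if Q x then 0 else 1) \<partial>N) = 0" if [measurable]: "Measurable.pred N Q" for Q
    by (subst nn_integral_0_iff_AE) (auto elim!: AE_mp)
  then show ?thesis
    using nn_integral_uminus[of "\<lambda>x. if P x then 0 else 1"] by simp
qed

text \<open>This is where a strictly positive kernel helps: the sum constraint imposes no geometric condition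
  on the support of \<open>h\<close>.\<close>

lemma six_pos:
  assumes [measurable]: "h \<in> borel_measurable N" "k \<in> borel_measurable borel"
    and h: "\<not> (AE x in N. h x = 0)" and k: "\<And>x. k x > 0"
  shows "six h k v > 0"
proof -
  have h': "\<not> (AE x in N. h (- x) = 0)"
    using h by (subst AE_uminus) auto
  show ?thesis
    by (intro conv_pos h h' k) auto
qed

lemma gauss_weighted_extension_le:
  assumes "e > 0" and U: "integrable N U"
  shows "(\<integral>\<^sup>+\<xi>. ennreal (gauss e \<xi> * (norm (osc N (\<lambda>x. x) U \<xi>)) ^ 6) \<partial>lborel)
    \<le> six (\<lambda>x. norm (U x)) (\<lambda>v. gauss_hat e v) 0"
proof -
  have [measurable]: "U \<in> borel_measurable N" using U by auto
  show ?thesis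
    by (rule order_trans[OF gauss_weighted_sextic_le[OF assms(1) _ _ U]], rule sigma_finite_measure_axioms)
       (use nn_integral_cube_cube[of "\<lambda>x. ennreal (norm (U x))" "\<lambda>v. ennreal (gauss_hat e v)"] in simp_all)
qed

lemma gauss_weighted_extension_eq:
  assumes "e > 0" and g: "integrable N g" "\<And>x. 0 \<le> g x"
  shows "(\<integral>\<^sup>+\<xi>. ennreal (gauss e \<xi> * (norm (osc N (\<lambda>x. x) (\<lambda>x. complex_of_real (g x)) \<xi>)) ^ 6) \<partial>lborel)
    = six g (\<lambda>v. gauss_hat e v) 0"
proof -
  have [measurable]: "g \<in> borel_measurable N" using g by auto
  show ?thesis
    by (subst gauss_weighted_sextic_eq[OF assms(1) _ _ g], rule sigma_finite_measure_axioms)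
       (use nn_integral_cube_cube[of "\<lambda>x. ennreal (g x)" "\<lambda>v. ennreal (gauss_hat e v)"] in simp_all)
qed

end

lemma gauss_mono: "e \<le> e' \<Longrightarrow> gauss e' x \<le> gauss e x"
  by (simp add: gauss_def mult_right_mono)

text \<open>The weights increase to \<open>1\<close> as \<open>e\<close> decreases to \<open>0\<close>, so monotone convergence removes them from
  any bound that is uniform in \<open>e\<close>.\<close>

lemma nn_integral_le_by_gauss:
  fixes F :: "'a::euclidean_space \<Rightarrow> real"
  assumes [measurable]: "F \<in> borel_measurable borel" and F: "\<And>x. 0 \<le> F x"
    and B: "\<And>e. 0 < e \<Longrightarrow> e \<le> 1 \<Longrightarrow> (\<integral>\<^sup>+x. ennreal (gauss e x * F x) \<partial>lborel) + c \<le> B"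
  shows "(\<integral>\<^sup>+x. ennreal (F x) \<partial>lborel) + c \<le> B"
proof -
  let ?e = "\<lambda>n. inverse (real (Suc n))"
  have "(\<lambda>n. \<integral>\<^sup>+x. ennreal (gauss (?e n) x * F x) \<partial>lborel) \<longlonglongrightarrow> (\<integral>\<^sup>+x. ennreal (F x) \<partial>lborel)"
  proof (rule nn_integral_LIMSEQ)
    show "incseq (\<lambda>n x. ennreal (gauss (?e n) x * F x))"
      by (auto simp: incseq_def le_fun_def intro!: ennreal_leI mult_right_mono gauss_mono F)
    show "(\<lambda>n. ennreal (gauss (?e n) x * F x)) \<longlonglongrightarrow> ennreal (F x)" for x
    proof -
      have "(\<lambda>n. gauss (?e n) x * F x) \<longlonglongrightarrow> exp (- (0 * (norm x)\<^sup>2 / 2)) * F x"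
        unfolding gauss_def by (intro tendsto_intros LIMSEQ_inverse_real_of_nat) simp
      then show ?thesis by (intro tendsto_ennrealI) simp
    qed
  qed measurable
  then have "(\<lambda>n. (\<integral>\<^sup>+x. ennreal (gauss (?e n) x * F x) \<partial>lborel) + c) \<longlonglongrightarrow> (\<integral>\<^sup>+x. ennreal (F x) \<partial>lborel) + c"
    by (intro tendsto_intros)
  then show ?thesis
    by (rule LIMSEQ_le_const2) (intro exI[of _ 0] allI impI B; simp add: field_simps)
qed

section \<open>Convolution cubes of short arcs\<close>

lemma nn_integral_gaussian:
  assumes k: "k > 0"
  shows "(\<integral>\<^sup>+x. ennreal (exp (- ((x - c)\<^sup>2 / k))) \<partial>lborel) = ennreal (sqrt (pi * k))"
proof -
  have "has_bochner_integral lborel (\<lambda>x. complex_of_real (exp (- (x\<^sup>2 / k)))) (complex_of_real (sqrt (pi * k)))"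
    using gauss_fourier_real[of "2 / k" 0] k by simp
  then have "has_bochner_integral lborel (\<lambda>x. exp (- (x\<^sup>2 / k))) (sqrt (pi * k))"
    by (simp add: has_bochner_integral_iff complex_of_real_integrable_eq)
  then have "(\<integral>\<^sup>+x. ennreal (exp (- (x\<^sup>2 / k))) \<partial>lborel) = ennreal (sqrt (pi * k))"
    by (subst nn_integral_eq_integral) (auto simp: has_bochner_integral_iff)
  then show ?thesis
    by (subst nn_integral_real_affine[where c = 1 and t = c]) auto
qed

lemma sin_ge_half:
  assumes "0 \<le> y" "y \<le> pi / 2"
  shows "y / 2 \<le> sin y"
proof -
  have "\<bar>sin y - y\<bar> \<le> inverse (fact 3) * \<bar>y\<bar> ^ 3"
    using Maclaurin_sin_bound[of y 3] by (simp add: numeral_3_eq_3 sin_coeff_def)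
  then have "y - y * (y * y) / 6 \<le> sin y"
    using assms by (simp add: power3_eq_cube fact_numeral abs_if mult.assoc split: if_splits)
  moreover have "y * y \<le> 1.6 * 1.6"
    using assms pi_approx by (intro mult_mono) auto
  then have "y * (y * y) \<le> y * 3"
    using assms by (intro mult_left_mono) auto
  ultimately show ?thesis by simp
qed

lemma abs_sin_ge_sixth:
  assumes "\<bar>y\<bar> \<le> 3 * pi / 4"
  shows "\<bar>y\<bar> / 6 \<le> \<bar>sin y\<bar>"
proof -
  have "y / 6 \<le> sin y" if "0 \<le> y" "y \<le> 3 * pi / 4" for y
  proof (cases "y \<le> pi / 2")
    case True
    with sin_ge_half[of y] that show ?thesis by simp
  next
    case False
    with sin_ge_half[of "pi - y"] that show ?thesis by simp
  qed
  from this[of "\<bar>y\<bar>"] assms show ?thesis by (cases "0 \<le> y") auto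
qed

text \<open>In polar coordinates \<open>\<bar>r cis \<alpha> - r' cis \<beta>\<bar>\<^sup>2 = (r - r')\<^sup>2 + 4 r r' sin\<^sup>2 ((\<alpha> - \<beta>) / 2)\<close>. The hypotheses keep
  \<open>\<alpha> - \<beta>\<close> below \<open>3 \<pi> / 2\<close> in modulus, short of the next zero of the sine, and both moduli
  are at least \<open>1\<close>, so the last term is at least a multiple of \<open>(\<alpha> - \<beta>)\<^sup>2\<close>.\<close>

lemma cmod_rotate_diff_ge:
  assumes z: "1 \<le> Re z" and w: "1 \<le> Re w" and d: "\<bar>\<theta> - \<phi>\<bar> \<le> pi / 2"
  shows "(cmod z - cmod w)\<^sup>2 + (\<theta> - (\<phi> + Arg w - Arg z))\<^sup>2 / 36 \<le> (cmod (cis \<theta> * z - cis \<phi> * w))\<^sup>2"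
proof -
  define u where "u = \<theta> - (\<phi> + Arg w - Arg z)"
  have args: "\<bar>Arg z\<bar> < pi / 2" "\<bar>Arg w\<bar> < pi / 2"
    using z w Re_Ln_pos_lt_imp[of z] Re_Ln_pos_lt_imp[of w] by (auto simp: Arg_def)
  have "\<bar>u\<bar> \<le> \<bar>\<theta> - \<phi>\<bar> + \<bar>Arg w\<bar> + \<bar>Arg z\<bar>"
    unfolding u_def by arith
  then have "\<bar>u / 2\<bar> \<le> 3 * pi / 4"
    using args d by simp
  then have "(\<bar>u / 2\<bar> / 6)\<^sup>2 \<le> (\<bar>sin (u / 2)\<bar>)\<^sup>2"
    by (intro power_mono abs_sin_ge_sixth) auto
  then have s: "u\<^sup>2 / 36 \<le> 4 * (sin (u / 2))\<^sup>2"
    by (simp add: power_divide)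
  have n: "1 \<le> cmod z" "1 \<le> cmod w"
    using z w complex_Re_le_cmod[of z] complex_Re_le_cmod[of w] by linarith+
  have "cis \<theta> * z - cis \<phi> * w = cis (\<phi> + Arg w) * (complex_of_real (cmod z) * cis u - complex_of_real (cmod w))"
  proof -
    have "z = complex_of_real (cmod z) * cis (Arg z)" "w = complex_of_real (cmod w) * cis (Arg w)"
      using rcis_cmod_Arg[of z] rcis_cmod_Arg[of w] by (simp_all add: rcis_def)
    then have "cis \<theta> * z - cis \<phi> * w
        = complex_of_real (cmod z) * (cis \<theta> * cis (Arg z)) - complex_of_real (cmod w) * (cis \<phi> * cis (Arg w))"
      by (metis mult.left_commute)
    moreover have "cis \<theta> * cis (Arg z) = cis (\<phi> + Arg w) * cis u"
      by (simp add: cis_mult u_def)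
    ultimately show ?thesis
      by (simp add: cis_mult[symmetric] algebra_simps)
  qed
  then have "(cmod (cis \<theta> * z - cis \<phi> * w))\<^sup>2 = (cmod z * cos u - cmod w)\<^sup>2 + (cmod z * sin u)\<^sup>2"
    by (simp add: norm_mult cmod_power2)
  also have "\<dots> = (cmod z)\<^sup>2 * ((sin u)\<^sup>2 + (cos u)\<^sup>2) + (cmod w)\<^sup>2 - 2 * cmod z * cmod w * cos u"
    by algebra
  also have "(sin u)\<^sup>2 + (cos u)\<^sup>2 = 1"
    by simp
  also have "cos u = 1 - 2 * (sin (u / 2))\<^sup>2"
    using cos_double_sin[of "u / 2"] by simp
  finally have "(cmod (cis \<theta> * z - cis \<phi> * w))\<^sup>2 = (cmod z - cmod w)\<^sup>2 + (cmod z * cmod w) * (4 * (sin (u / 2))\<^sup>2)"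
    by (simp add: power2_eq_square algebra_simps)
  moreover have "1 * (4 * (sin (u / 2))\<^sup>2) \<le> (cmod z * cmod w) * (4 * (sin (u / 2))\<^sup>2)"
    using mult_mono[OF n] by (intro mult_right_mono) auto
  ultimately show ?thesis
    using s unfolding u_def by linarith
qed

text \<open>Three points \<open>cis \<theta>\<close>, \<open>cis (\<theta> + a)\<close>, \<open>cis (\<theta> + b)\<close> have sum \<open>cis \<theta> * tri a b\<close>: the modulus of the sum
  depends on the differences \<open>a\<close> and \<open>b\<close> only, and \<open>\<theta>\<close> rotates it.\<close>

definition tri :: "real \<Rightarrow> real \<Rightarrow> complex" where
  "tri a b = 1 + cis a + cis b"

definition tri_sq :: "real \<Rightarrow> real \<Rightarrow> real" where
  "tri_sq a b = 3 + 2 * cos a + 2 * cos b + 2 * cos (a - b)"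

lemma cmod_tri: "(cmod (tri a b))\<^sup>2 = tri_sq a b"
proof -
  have "(cmod (tri a b))\<^sup>2 = 1 + ((sin a)\<^sup>2 + (cos a)\<^sup>2) + ((sin b)\<^sup>2 + (cos b)\<^sup>2)
      + 2 * cos a + 2 * cos b + 2 * (cos a * cos b + sin a * sin b)"
    unfolding cmod_power2 tri_def
    by (simp add: power2_eq_square algebra_simps)
       (use sin_cos_squared_add3[of a] sin_cos_squared_add3[of b] in linarith)
  then show ?thesis
    by (simp add: tri_sq_def cos_diff)
qed

text \<open>Along the ray through \<open>(1, s)\<close> the function \<open>tri_sq\<close> decreases from its maximum at the origin with
  slope at least \<open>a\<close> in modulus. The factor \<open>a\<close> in the integrand, which is the Jacobian of \<open>b = s * a\<close>, is
  therefore paid for by the substitution that takes \<open>tri_sq\<close> as the new variable.\<close>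

lemma ray_integral_le:
  assumes s: "\<bar>s\<bar> \<le> 1" and k: "k > 0"
  shows "(\<integral>\<^sup>+a. ennreal (a * exp (- ((tri_sq a (s * a) - h)\<^sup>2 / k))) * indicator {0..pi / 2} a \<partial>lborel)
    \<le> ennreal (sqrt (pi * k))"
proof -
  let ?g = "\<lambda>a. - tri_sq a (s * a)"
  let ?g' = "\<lambda>a. 2 * sin a + 2 * s * sin (s * a) + 2 * (1 - s) * sin ((1 - s) * a)"
  let ?f = "\<lambda>v. exp (- ((v - (- h))\<^sup>2 / k))"
  \<comment> \<open>All three terms of the derivative are nonnegative, because \<open>\<bar>s * a\<bar>\<close> and \<open>(1 - s) * a\<close> are at
    most \<open>\<pi>\<close>; the first one alone is at least \<open>a\<close>.\<close>
  have g': "a \<le> ?g' a" if a: "a \<in> {0..pi / 2}" for a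
  proof -
    have "0 \<le> s * sin (s * a)"
    proof (cases "0 \<le> s")
      case True
      then have "s * a \<le> 1 * (pi / 2)" using s a by (intro mult_mono) auto
      then show ?thesis using True a by (intro mult_nonneg_nonneg sin_ge_zero) auto
    next
      case False
      then have "(- s) * a \<le> 1 * (pi / 2)" using s a by (intro mult_mono) auto
      then have "0 \<le> (- s) * sin ((- s) * a)" using False a by (intro mult_nonneg_nonneg sin_ge_zero) auto
      then show ?thesis by simp
    qed
    moreover have "(1 - s) * a \<le> 2 * (pi / 2)" using s a by (intro mult_mono) auto
    then have "0 \<le> (1 - s) * sin ((1 - s) * a)"
      using s a by (intro mult_nonneg_nonneg sin_ge_zero) auto
    moreover have "a \<le> 2 * sin a"
      using sin_ge_half[of a] a by simp
    ultimately show ?thesis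
      unfolding mult.assoc by linarith
  qed
  have "(\<integral>\<^sup>+a. ennreal (a * exp (- ((tri_sq a (s * a) - h)\<^sup>2 / k))) * indicator {0..pi / 2} a \<partial>lborel)
      \<le> (\<integral>\<^sup>+a. ennreal (?f (?g a) * ?g' a * indicator {0..pi / 2} a) \<partial>lborel)"
  proof (rule nn_integral_mono)
    fix a :: real
    have "(- tri_sq a (s * a) - - h)\<^sup>2 = (tri_sq a (s * a) - h)\<^sup>2"
      by (simp add: power2_eq_square algebra_simps)
    then show "ennreal (a * exp (- ((tri_sq a (s * a) - h)\<^sup>2 / k))) * indicator {0..pi / 2} a
        \<le> ennreal (?f (?g a) * ?g' a * indicator {0..pi / 2} a)"
      using g'[of a] by (auto simp: indicator_def mult.commute intro!: ennreal_leI mult_left_mono)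
  qed
  also have "\<dots> = (\<integral>\<^sup>+v. ennreal (?f v * indicator {?g 0..?g (pi / 2)} v) \<partial>lborel)"
  proof (rule nn_integral_substitution[symmetric])
    show "(?g has_real_derivative ?g' a) (at a)" for a
      unfolding tri_sq_def by (auto intro!: derivative_eq_intros simp: algebra_simps)
    show "0 \<le> ?g' a" if "a \<in> {0..pi / 2}" for a
      using g'[OF that] that by simp
    show "continuous_on {0..pi / 2} ?g'"
      by (intro continuous_intros)
  qed (auto simp: set_borel_measurable_def)
  also have "\<dots> \<le> (\<integral>\<^sup>+v. ennreal (?f v) \<partial>lborel)"
    by (intro nn_integral_mono ennreal_leI) (auto simp: indicator_def)
  also have "\<dots> = ennreal (sqrt (pi * k))"
    by (rule nn_integral_gaussian[OF k])
  finally show ?thesis .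
qed

lemma tri_sq_commute: "tri_sq a b = tri_sq b a"
  unfolding tri_sq_def cos_diff by (simp add: algebra_simps)

lemma tri_sq_minus: "tri_sq (- a) (- b) = tri_sq a b"
  unfolding tri_sq_def cos_diff by simp

lemma measurable_tri_sq [measurable (raw)]:
  assumes [measurable]: "f \<in> borel_measurable M" "g \<in> borel_measurable M"
  shows "(\<lambda>p. tri_sq (f p) (g p)) \<in> borel_measurable M"
  unfolding tri_sq_def by measurable

text \<open>The two symmetries cut the plane into four copies of the sector \<open>\<bar>b\<bar> \<le> a\<close>, on which \<open>b = s * a\<close> is a
  change of variables with \<open>s\<close> between \<open>- 1\<close> and \<open>1\<close>.\<close>

lemma nn_integral_sector_le:
  fixes \<psi> :: "real \<Rightarrow> real \<Rightarrow> ennreal"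
  assumes m: "case_prod \<psi> \<in> borel_measurable (borel \<Otimes>\<^sub>M borel)"
    and sym: "\<And>a b. \<psi> a b = \<psi> b a" and neg: "\<And>a b. \<psi> (- a) (- b) = \<psi> a b"
  shows "(\<integral>\<^sup>+a. \<integral>\<^sup>+b. \<psi> a b \<partial>lborel \<partial>lborel)
    \<le> 4 * (\<integral>\<^sup>+s. \<integral>\<^sup>+a. (ennreal a * \<psi> a (s * a)) * indicator {0..} a * indicator {-1..1} s \<partial>lborel \<partial>lborel)"
proof -
  have m2 [measurable]: "(\<lambda>p. \<psi> (f p) (g p)) \<in> borel_measurable (borel \<Otimes>\<^sub>M borel)"
    if "f \<in> borel_measurable (borel \<Otimes>\<^sub>M borel)" "g \<in> borel_measurable (borel \<Otimes>\<^sub>M borel)"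
    for f g :: "real \<times> real \<Rightarrow> real"
    using measurable_compose[OF measurable_Pair[OF that] m] by simp
  have m1 [measurable]: "(\<lambda>p. \<psi> (f p) (g p)) \<in> borel_measurable borel"
    if "f \<in> borel_measurable borel" "g \<in> borel_measurable borel" for f g :: "real \<Rightarrow> real"
    using measurable_compose[OF measurable_Pair[OF that] m] by simp
  define \<omega> where "\<omega> a b = (if \<bar>b\<bar> \<le> \<bar>a\<bar> then \<psi> a b else 0)" for a b
  have \<omega>1 [measurable]: "(\<lambda>p. \<omega> (fst p) (snd p)) \<in> borel_measurable (borel \<Otimes>\<^sub>M borel)"
    unfolding \<omega>_def by measurable
  have \<omega>2 [measurable]: "(\<lambda>p. \<omega> (snd p) (fst p)) \<in> borel_measurable (borel \<Otimes>\<^sub>M borel)"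
    unfolding \<omega>_def by measurable
  have \<omega>3 [measurable]: "(\<lambda>b. \<omega> a b) \<in> borel_measurable borel" "(\<lambda>b. \<omega> b a) \<in> borel_measurable borel" for a
    unfolding \<omega>_def by measurable
  define L where "L a = (\<integral>\<^sup>+b. \<omega> a b \<partial>lborel)" for a
  have L [measurable]: "L \<in> borel_measurable borel"
    unfolding L_def[abs_def]
    by (rule lborel.borel_measurable_nn_integral) (use \<omega>1 in \<open>simp add: case_prod_unfold\<close>)
  have "(\<integral>\<^sup>+a. \<integral>\<^sup>+b. \<psi> a b \<partial>lborel \<partial>lborel) \<le> (\<integral>\<^sup>+a. \<integral>\<^sup>+b. \<omega> a b + \<omega> b a \<partial>lborel \<partial>lborel)"
  proof (intro nn_integral_mono)
    fix a b :: real
    show "\<psi> a b \<le> \<omega> a b + \<omega> b a"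
      using sym[of a b] by (auto simp: \<omega>_def)
  qed
  also have "\<dots> = (\<integral>\<^sup>+a. L a + (\<integral>\<^sup>+b. \<omega> b a \<partial>lborel) \<partial>lborel)"
    unfolding L_def by (intro nn_integral_cong nn_integral_add) simp_all
  also have "\<dots> = (\<integral>\<^sup>+a. L a \<partial>lborel) + (\<integral>\<^sup>+a. \<integral>\<^sup>+b. \<omega> b a \<partial>lborel \<partial>lborel)"
    by (intro nn_integral_add lborel.borel_measurable_nn_integral) (use \<omega>2 in \<open>simp_all add: case_prod_unfold\<close>)
  also have "(\<integral>\<^sup>+a. \<integral>\<^sup>+b. \<omega> b a \<partial>lborel \<partial>lborel) = (\<integral>\<^sup>+a. L a \<partial>lborel)"
    unfolding L_def by (rule lborel_pair.Fubini') (use \<omega>1 in \<open>simp add: case_prod_unfold\<close>)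
  also have "(\<integral>\<^sup>+a. L a \<partial>lborel) \<le> (\<integral>\<^sup>+a. L a * indicator {0..} a + L a * indicator {..0} a \<partial>lborel)"
    by (intro nn_integral_mono) (auto simp: indicator_def)
  also have "\<dots> = (\<integral>\<^sup>+a. L a * indicator {0..} a \<partial>lborel) + (\<integral>\<^sup>+a. L a * indicator {..0} a \<partial>lborel)"
    by (rule nn_integral_add) measurable
  also have "(\<integral>\<^sup>+a. L a * indicator {..0} a \<partial>lborel) = (\<integral>\<^sup>+a. L (- a) * indicator {..0} (- a) \<partial>lborel)"
    by (subst nn_integral_real_affine[where c = "-1" and t = 0]) auto
  also have "\<dots> = (\<integral>\<^sup>+a. L a * indicator {0..} a \<partial>lborel)"
  proof (rule nn_integral_cong)
    fix a :: real
    have "L (- a) = (\<integral>\<^sup>+b. \<omega> (- a) (- b) \<partial>lborel)"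
      unfolding L_def by (subst nn_integral_real_affine[where c = "-1" and t = 0]) auto
    also have "\<dots> = L a"
      unfolding L_def by (intro nn_integral_cong) (simp add: \<omega>_def neg)
    finally show "L (- a) * indicator {..0} (- a) = L a * indicator {0..} a"
      by (simp add: indicator_def)
  qed
  also have "(\<integral>\<^sup>+a. L a * indicator {0..} a \<partial>lborel)
      \<le> (\<integral>\<^sup>+a. \<integral>\<^sup>+s. (ennreal a * \<psi> a (s * a)) * indicator {0..} a * indicator {-1..1} s \<partial>lborel \<partial>lborel)"
  proof (rule nn_integral_mono)
    fix a :: real
    show "L a * indicator {0..} a \<le> (\<integral>\<^sup>+s. (ennreal a * \<psi> a (s * a)) * indicator {0..} a * indicator {-1..1} s \<partial>lborel)"
      (is "_ \<le> ?R")
    proof (cases "a > 0")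
      case True
      have "L a = ennreal a * (\<integral>\<^sup>+s. \<omega> a (s * a) \<partial>lborel)"
        unfolding L_def
        using True by (subst nn_integral_real_affine[where c = a and t = 0]) (auto simp: mult.commute)
      also have "\<dots> = (\<integral>\<^sup>+s. ennreal a * \<omega> a (s * a) \<partial>lborel)"
        by (rule nn_integral_cmult[symmetric]) (simp add: \<omega>_def)
      also have "\<dots> \<le> ?R"
      proof (rule nn_integral_mono)
        fix s :: real
        have "\<bar>s * a\<bar> \<le> \<bar>a\<bar> \<longleftrightarrow> \<bar>s\<bar> \<le> 1"
          using True by (simp add: abs_mult mult_le_cancel_right2)
        then show "ennreal a * \<omega> a (s * a) \<le> (ennreal a * \<psi> a (s * a)) * indicator {0..} a * indicator {-1..1} s"
          using True by (auto simp: \<omega>_def indicator_def)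
      qed
      finally show ?thesis using True by simp
    next
      case False
      have "AE b in lborel. \<omega> 0 b = 0"
        by (rule eventually_mono[OF AE_lborel_singleton[of 0]]) (simp add: \<omega>_def)
      then have "L 0 = 0"
        unfolding L_def by (subst nn_integral_0_iff_AE) simp_all
      with False show ?thesis by (cases "a = 0") auto
    qed
  qed
  also have "\<dots> = (\<integral>\<^sup>+s. \<integral>\<^sup>+a. (ennreal a * \<psi> a (s * a)) * indicator {0..} a * indicator {-1..1} s \<partial>lborel \<partial>lborel)" (is "_ = ?R")
    by (rule lborel_pair.Fubini'[symmetric]) measurable
  finally have "(\<integral>\<^sup>+a. \<integral>\<^sup>+b. \<psi> a b \<partial>lborel \<partial>lborel) \<le> (?R + ?R) + (?R + ?R)"
    by (simp add: add_mono)
  also have "\<dots> = 4 * ?R"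
  proof -
    have "(x + x) + (x + x) = (2 * 2) * x" for x :: ennreal
      by (simp only: mult_2 distrib_right)
    then show ?thesis by simp
  qed
  finally show ?thesis .
qed

text \<open>Near its maximum \<open>9\<close>, attained at the origin, the level sets of \<open>tri_sq\<close> are closed curves that
  shrink to a point as the level tends to \<open>9\<close>. Integrating along rays gives a bound which is uniform in this
  degeneration.\<close>

lemma planar_integral_le:
  assumes k: "k > 0"
  shows "(\<integral>\<^sup>+a. \<integral>\<^sup>+b. ennreal (exp (- ((tri_sq a b - h)\<^sup>2 / k)))
      * indicator {- (pi / 2)..pi / 2} a * indicator {- (pi / 2)..pi / 2} b \<partial>lborel \<partial>lborel)
    \<le> ennreal (8 * sqrt (pi * k))"
proof -
  let ?I = "{- (pi / 2)..pi / 2} :: real set"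
  let ?\<psi> = "\<lambda>a b. ennreal (exp (- ((tri_sq a b - h)\<^sup>2 / k))) * indicator ?I a * indicator ?I b"
  have "(\<integral>\<^sup>+a. \<integral>\<^sup>+b. ?\<psi> a b \<partial>lborel \<partial>lborel)
    \<le> 4 * (\<integral>\<^sup>+s. \<integral>\<^sup>+a. (ennreal a * ?\<psi> a (s * a)) * indicator {0..} a * indicator {-1..1} s \<partial>lborel \<partial>lborel)"
  proof (rule nn_integral_sector_le)
    show "?\<psi> a b = ?\<psi> b a" for a b
      unfolding tri_sq_commute[of b a] by (simp add: mult_ac)
    show "?\<psi> (- a) (- b) = ?\<psi> a b" for a b
      unfolding tri_sq_minus by (auto simp: indicator_def)
  qed measurable
  also have "\<dots> \<le> 4 * (\<integral>\<^sup>+s. ennreal (sqrt (pi * k)) * indicator {-1..1} s \<partial>(lborel :: real measure))"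
  proof (intro mult_left_mono nn_integral_mono)
    fix s :: real
    show "(\<integral>\<^sup>+a. (ennreal a * ?\<psi> a (s * a)) * indicator {0..} a * indicator {-1..1} s \<partial>lborel)
        \<le> ennreal (sqrt (pi * k)) * indicator {-1..1} s"
    proof (cases "\<bar>s\<bar> \<le> 1")
      case True
      have "(\<integral>\<^sup>+a. (ennreal a * ?\<psi> a (s * a)) * indicator {0..} a * indicator {-1..1} s \<partial>lborel)
          \<le> (\<integral>\<^sup>+a. ennreal (a * exp (- ((tri_sq a (s * a) - h)\<^sup>2 / k))) * indicator {0..pi / 2} a \<partial>lborel)"
        by (intro nn_integral_mono) (auto simp: indicator_def ennreal_mult')
      with ray_integral_le[OF True k, of h] True show ?thesis
        by (auto simp: indicator_def)
    qed (auto simp: indicator_def)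
  qed simp
  also have "\<dots> = ennreal (8 * sqrt (pi * k))"
  proof -
    have "4 * (x * 2) = 8 * x" for x :: ennreal
      by (simp only: mult.commute[of x 2] mult.assoc[symmetric]) simp
    then show ?thesis
      using k by (simp add: nn_integral_cmult_indicator ennreal_mult')
  qed
  finally show ?thesis .
qed

lemma measurable_cis [measurable]: "cis \<in> borel_measurable borel"
  by (intro borel_measurable_continuous_onI continuous_intros)

lemma measurable_circle_param_borel: "circle_param \<in> borel \<rightarrow>\<^sub>M restrict_space borel S1"
proof -
  have "sets (restrict_space lborel UNIV) = sets (borel :: real measure)"
    by (simp add: sets_restrict_space)
  from measurable_cong_sets[OF this refl] measurable_circle_param[of UNIV] show ?thesis
    by simp
qed

lemma borel_measurable_circle_param [measurable]: "circle_param \<in> borel_measurable borel"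
  using measurable_circle_param_borel by (simp add: measurable_restrict_space2_iff)

lemma norm_sum3_circle_param_diff:
  "norm (sum3 circle_param p - sum3 circle_param q) = cmod (sum3 cis p - sum3 cis q)"
  by (simp add: norm_vec_def L2_set_def sum_2 sum3_def circle_param_def cmod_def)

lemma sum3_cis_eq: "sum3 cis (\<theta>, \<theta> + a, \<theta> + b) = cis \<theta> * tri a b"
  by (simp add: sum3_def tri_def cis_mult[symmetric] algebra_simps)

lemma Re_tri_ge_1: "\<bar>a\<bar> \<le> pi / 2 \<Longrightarrow> \<bar>b\<bar> \<le> pi / 2 \<Longrightarrow> 1 \<le> Re (tri a b)"
  using cos_ge_zero[of a] cos_ge_zero[of b] by (simp add: tri_def abs_le_iff)

lemma cmod_tri_le: "cmod (tri a b) \<le> 3"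
proof -
  have "cmod (tri a b) \<le> cmod (1 + cis a) + cmod (cis b)"
    unfolding tri_def by (rule norm_triangle_ineq)
  also have "cmod (1 + cis a) \<le> cmod 1 + cmod (cis a)"
    by (rule norm_triangle_ineq)
  finally show ?thesis by simp
qed

text \<open>The factor \<open>exp (- (tri_sq a b - tri_sq a' b')\<^sup>2 / (72 e))\<close> records that the two moduli must nearly agree;
  integrating the remaining Gaussian in the angle costs the square root. The number \<open>72 = 2 * 36\<close> serves both
  factors: \<open>36\<close> bounds the square of the sum of the two moduli, and it is also the constant of
  \<open>cmod_rotate_diff_ge\<close>.\<close>

lemma rotation_integral_le:
  assumes e: "e > 0" and a: "\<bar>a\<bar> \<le> pi / 2" "\<bar>b\<bar> \<le> pi / 2" and a': "\<bar>a'\<bar> \<le> pi / 2" "\<bar>b'\<bar> \<le> pi / 2"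
    and \<phi>: "\<phi> \<in> {c..c + pi / 2}"
  shows "(\<integral>\<^sup>+\<theta>. ennreal (exp (- ((cmod (cis \<theta> * tri a b - cis \<phi> * tri a' b'))\<^sup>2 / (2 * e)))) * indicator {c..c + pi / 2} \<theta> \<partial>lborel)
    \<le> ennreal (exp (- ((tri_sq a b - tri_sq a' b')\<^sup>2 / (72 * e)))) * ennreal (sqrt (pi * (72 * e)))"
proof -
  let ?z = "tri a b" and ?w = "tri a' b'"
  let ?\<psi> = "\<phi> + Arg ?w - Arg ?z"
  have "(tri_sq a b - tri_sq a' b')\<^sup>2 = (cmod ?z + cmod ?w)\<^sup>2 * (cmod ?z - cmod ?w)\<^sup>2"
    by (simp add: cmod_tri[symmetric] power2_eq_square algebra_simps)
  also have "\<dots> \<le> 6\<^sup>2 * (cmod ?z - cmod ?w)\<^sup>2"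
    using cmod_tri_le[of a b] cmod_tri_le[of a' b'] by (intro mult_right_mono power_mono) auto
  finally have 1: "(tri_sq a b - tri_sq a' b')\<^sup>2 / 36 \<le> (cmod ?z - cmod ?w)\<^sup>2"
    by simp
  have "ennreal (exp (- ((cmod (cis \<theta> * ?z - cis \<phi> * ?w))\<^sup>2 / (2 * e)))) * indicator {c..c + pi / 2} \<theta>
      \<le> ennreal (exp (- ((tri_sq a b - tri_sq a' b')\<^sup>2 / (72 * e)))) * ennreal (exp (- ((\<theta> - ?\<psi>)\<^sup>2 / (72 * e))))" for \<theta>
  proof (cases "\<theta> \<in> {c..c + pi / 2}")
    case True
    with \<phi> have "\<bar>\<theta> - \<phi>\<bar> \<le> pi / 2" by (auto simp: abs_if)
    then have "(cmod ?z - cmod ?w)\<^sup>2 + (\<theta> - ?\<psi>)\<^sup>2 / 36 \<le> (cmod (cis \<theta> * ?z - cis \<phi> * ?w))\<^sup>2"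
      by (intro cmod_rotate_diff_ge Re_tri_ge_1 a a')
    with 1 have "((tri_sq a b - tri_sq a' b')\<^sup>2 / 36 + (\<theta> - ?\<psi>)\<^sup>2 / 36) / (2 * e)
        \<le> (cmod (cis \<theta> * ?z - cis \<phi> * ?w))\<^sup>2 / (2 * e)"
      using e by (intro divide_right_mono) linarith+
    moreover have "((tri_sq a b - tri_sq a' b')\<^sup>2 / 36 + (\<theta> - ?\<psi>)\<^sup>2 / 36) / (2 * e)
        = (tri_sq a b - tri_sq a' b')\<^sup>2 / (72 * e) + (\<theta> - ?\<psi>)\<^sup>2 / (72 * e)"
      by (simp add: add_divide_distrib)
    ultimately show ?thesis
      using True by (simp add: ennreal_mult[symmetric] exp_add[symmetric])
  qed simp
  then have "(\<integral>\<^sup>+\<theta>. ennreal (exp (- ((cmod (cis \<theta> * ?z - cis \<phi> * ?w))\<^sup>2 / (2 * e)))) * indicator {c..c + pi / 2} \<theta> \<partial>lborel)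
      \<le> (\<integral>\<^sup>+\<theta>. ennreal (exp (- ((tri_sq a b - tri_sq a' b')\<^sup>2 / (72 * e)))) * ennreal (exp (- ((\<theta> - ?\<psi>)\<^sup>2 / (72 * e)))) \<partial>lborel)"
    by (intro nn_integral_mono)
  also have "\<dots> = ennreal (exp (- ((tri_sq a b - tri_sq a' b')\<^sup>2 / (72 * e)))) * ennreal (sqrt (pi * (72 * e)))"
    using e by (simp add: nn_integral_cmult nn_integral_gaussian)
  finally show ?thesis .
qed

text \<open>The smoothed triple self-convolution of arc length on a quarter circle is bounded at sums of three
  points of the same quarter, uniformly in \<open>e\<close>. In the variables \<open>\<theta>\<close>, \<open>a\<close>, \<open>b\<close> the rotation and the planar
  integral contribute a multiple of the square root of \<open>e\<close> each, which cancels the normalization \<open>2 \<pi> / e\<close> of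
  the Gaussian.\<close>

lemma arc_kernel_le:
  assumes e: "e > 0" and p: "p \<in> {c..c + pi / 2} \<times> {c..c + pi / 2} \<times> {c..c + pi / 2}"
  shows "(\<integral>\<^sup>+q. ennreal (gauss_hat e (sum3 circle_param p - sum3 circle_param q))
      * indicator ({c..c + pi / 2} \<times> {c..c + pi / 2} \<times> {c..c + pi / 2}) q \<partial>cube_measure lborel)
    \<le> ennreal (1152 * pi\<^sup>2)"
proof -
  let ?I = "{c..c + pi / 2}" and ?J = "{- (pi / 2)..pi / 2}"
  obtain \<phi> a' b' where p_eq: "p = (\<phi>, \<phi> + a', \<phi> + b')"
    using that[of "fst p" "fst (snd p) - fst p" "snd (snd p) - fst p"] by simp
  have \<phi>: "\<phi> \<in> ?I" and ab': "\<bar>a'\<bar> \<le> pi / 2" "\<bar>b'\<bar> \<le> pi / 2"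
    using p by (auto simp: p_eq abs_le_iff)
  let ?x = "cis \<phi> * tri a' b'" and ?h = "tri_sq a' b'"
  let ?E = "\<lambda>\<theta> a b. ennreal (exp (- ((cmod (cis \<theta> * tri a b - ?x))\<^sup>2 / (2 * e))))"
  let ?H = "\<lambda>t y z. ennreal (gauss_hat e (sum3 circle_param p - sum3 circle_param (t, y, z))) * (indicator ?I t * indicator ?I y * indicator ?I z)"
  have [measurable]: "sum3 circle_param \<in> borel_measurable (cube_measure borel)"
    by (rule measurable_sum3) measurable
  have sm: "(\<lambda>q. ennreal (gauss_hat e (sum3 circle_param p - sum3 circle_param q))) \<in> borel_measurable (cube_measure borel)"
    by measurable
  have Hm: "(\<lambda>q. ?H (f q) (g q) (h q)) \<in> borel_measurable borel"
    if [measurable]: "f \<in> borel_measurable borel" "g \<in> borel_measurable borel" "h \<in> borel_measurable borel" for f g h :: "real \<Rightarrow> real"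
    unfolding sum3_def fst_conv snd_conv by measurable
  \<comment> \<open>Two points of an interval of length \<open>\<pi> / 2\<close> differ by at most \<open>\<pi> / 2\<close>, so the differences \<open>a\<close> and \<open>b\<close>
    of points of \<open>?I\<close> lie in \<open>?J\<close>.\<close>
  have le: "?H \<theta> (\<theta> + a) (\<theta> + b) \<le> ennreal (2 * pi / e) * (?E \<theta> a b * indicator ?I \<theta> * indicator ?J a * indicator ?J b)" for \<theta> a b
  proof -
    have "norm (sum3 circle_param p - sum3 circle_param (\<theta>, \<theta> + a, \<theta> + b)) = cmod (cis \<theta> * tri a b - ?x)"
      unfolding norm_sum3_circle_param_diff p_eq sum3_cis_eq by (rule norm_minus_commute)
    then have "ennreal (gauss_hat e (sum3 circle_param p - sum3 circle_param (\<theta>, \<theta> + a, \<theta> + b))) = ennreal (2 * pi / e) * ?E \<theta> a b"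
      using e by (simp add: gauss_hat_def ennreal_mult[symmetric])
    then show ?thesis by (auto simp: indicator_def)
  qed
  have K: "ennreal (2 * pi / e * sqrt (pi * (72 * e))) = ennreal (2 * pi / e) * ennreal (sqrt (pi * (72 * e)))"
    using e by (intro ennreal_mult) auto
  have Em: "(\<lambda>q. ?E (f q) (g q) (h q)) \<in> borel_measurable M"
    if [measurable]: "f \<in> borel_measurable M" "g \<in> borel_measurable M" "h \<in> borel_measurable M" for f g h and M :: "'x measure"
    unfolding tri_def by measurable
  have "(\<integral>\<^sup>+q. ennreal (gauss_hat e (sum3 circle_param p - sum3 circle_param q)) * indicator (?I \<times> ?I \<times> ?I) q \<partial>cube_measure lborel)
      = (\<integral>\<^sup>+\<theta>. \<integral>\<^sup>+y. \<integral>\<^sup>+z. ?H \<theta> y z \<partial>lborel \<partial>lborel \<partial>lborel)"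
    by (subst nn_integral_cube[OF lborel.sigma_finite_measure_axioms])
       (auto intro!: nn_integral_cong borel_measurable_times_ennreal sm simp: indicator_def cong: measurable_cong_sets)
  also have "\<dots> = (\<integral>\<^sup>+\<theta>. \<integral>\<^sup>+a. \<integral>\<^sup>+b. ?H \<theta> (\<theta> + a) (\<theta> + b) \<partial>lborel \<partial>lborel \<partial>lborel)"
  proof (rule nn_integral_cong)
    fix \<theta> :: real
    have "(\<integral>\<^sup>+y. \<integral>\<^sup>+z. ?H \<theta> y z \<partial>lborel \<partial>lborel) = (\<integral>\<^sup>+a. \<integral>\<^sup>+z. ?H \<theta> (\<theta> + a) z \<partial>lborel \<partial>lborel)"
      by (subst nn_integral_real_affine[where c = 1 and t = \<theta>]) (simp_all add: sum3_def)
    also have "\<dots> = (\<integral>\<^sup>+a. \<integral>\<^sup>+b. ?H \<theta> (\<theta> + a) (\<theta> + b) \<partial>lborel \<partial>lborel)"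
      by (rule nn_integral_cong, subst nn_integral_real_affine[where c = 1 and t = \<theta>]) (simp_all add: sum3_def)
    finally show "(\<integral>\<^sup>+y. \<integral>\<^sup>+z. ?H \<theta> y z \<partial>lborel \<partial>lborel) = \<dots>" .
  qed
  also have "\<dots> \<le> (\<integral>\<^sup>+\<theta>. \<integral>\<^sup>+a. \<integral>\<^sup>+b. ennreal (2 * pi / e) * (?E \<theta> a b * indicator ?I \<theta> * indicator ?J a * indicator ?J b) \<partial>lborel \<partial>lborel \<partial>lborel)"
    by (intro nn_integral_mono le)
  also have "\<dots> = (\<integral>\<^sup>+a. \<integral>\<^sup>+\<theta>. \<integral>\<^sup>+b. ennreal (2 * pi / e) * (?E \<theta> a b * indicator ?I \<theta> * indicator ?J a * indicator ?J b) \<partial>lborel \<partial>lborel \<partial>lborel)"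
    by (rule lborel_pair.Fubini') (use Em in measurable)
  also have "\<dots> = (\<integral>\<^sup>+a. \<integral>\<^sup>+b. \<integral>\<^sup>+\<theta>. ennreal (2 * pi / e) * (?E \<theta> a b * indicator ?I \<theta> * indicator ?J a * indicator ?J b) \<partial>lborel \<partial>lborel \<partial>lborel)"
    by (intro nn_integral_cong lborel_pair.Fubini') (use Em in measurable)
  also have "\<dots> \<le> (\<integral>\<^sup>+a. \<integral>\<^sup>+b. ennreal (2 * pi / e * sqrt (pi * (72 * e))) * (ennreal (exp (- ((tri_sq a b - ?h)\<^sup>2 / (72 * e)))) * indicator ?J a * indicator ?J b) \<partial>lborel \<partial>lborel)"
  proof (intro nn_integral_mono)
    fix a b :: real
    show "(\<integral>\<^sup>+\<theta>. ennreal (2 * pi / e) * (?E \<theta> a b * indicator ?I \<theta> * indicator ?J a * indicator ?J b) \<partial>lborel)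
       \<le> ennreal (2 * pi / e * sqrt (pi * (72 * e))) * (ennreal (exp (- ((tri_sq a b - ?h)\<^sup>2 / (72 * e)))) * indicator ?J a * indicator ?J b)"
    proof (cases "a \<in> ?J \<and> b \<in> ?J")
      case True
      then have ab: "\<bar>a\<bar> \<le> pi / 2" "\<bar>b\<bar> \<le> pi / 2" by auto
      have "(\<integral>\<^sup>+\<theta>. ennreal (2 * pi / e) * (?E \<theta> a b * indicator ?I \<theta>) \<partial>lborel)
          = ennreal (2 * pi / e) * (\<integral>\<^sup>+\<theta>. ?E \<theta> a b * indicator ?I \<theta> \<partial>lborel)"
        by (rule nn_integral_cmult) measurable
      also have "\<dots> \<le> ennreal (2 * pi / e) * (ennreal (exp (- ((tri_sq a b - ?h)\<^sup>2 / (72 * e)))) * ennreal (sqrt (pi * (72 * e))))"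
        by (intro mult_left_mono rotation_integral_le[OF e ab ab' \<phi>]) simp
      finally show ?thesis
        using True unfolding K by (simp add: mult_ac)
    qed auto
  qed
  also have "\<dots> = ennreal (2 * pi / e * sqrt (pi * (72 * e))) * (\<integral>\<^sup>+a. \<integral>\<^sup>+b. ennreal (exp (- ((tri_sq a b - ?h)\<^sup>2 / (72 * e)))) * indicator ?J a * indicator ?J b \<partial>lborel \<partial>lborel)"
  proof -
    have "(\<integral>\<^sup>+b. ennreal C * (ennreal (exp (- ((tri_sq a b - ?h)\<^sup>2 / (72 * e)))) * indicator ?J a * indicator ?J b) \<partial>lborel)
        = ennreal C * (\<integral>\<^sup>+b. ennreal (exp (- ((tri_sq a b - ?h)\<^sup>2 / (72 * e)))) * indicator ?J a * indicator ?J b \<partial>lborel)" for a C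
      by (rule nn_integral_cmult) measurable
    then show ?thesis
      by (simp only:) (rule nn_integral_cmult, measurable)
  qed
  also have "\<dots> \<le> ennreal (2 * pi / e * sqrt (pi * (72 * e))) * ennreal (8 * sqrt (pi * (72 * e)))"
    using e by (intro mult_left_mono planar_integral_le) auto
  also have "\<dots> = ennreal (1152 * pi\<^sup>2)"
  proof -
    have "sqrt (pi * (72 * e)) * sqrt (pi * (72 * e)) = pi * (72 * e)"
      using e by simp
    then have "(2 * pi / e * sqrt (pi * (72 * e))) * (8 * sqrt (pi * (72 * e))) = 16 * pi / e * (pi * (72 * e))"
      by (simp only: mult_ac divide_inverse) 
    also have "\<dots> = 1152 * pi\<^sup>2"
      using e by (simp add: power2_eq_square)
    finally show ?thesis
      using e by (subst ennreal_mult[symmetric]) auto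
  qed
  finally show ?thesis .
qed

section \<open>Finiteness of the sixth moment\<close>

text \<open>Replacing \<open>V x * V y\<close> by the larger of the two squares leaves a single square to
  integrate against the kernel in the other variable.\<close>

lemma schur_test:
  fixes K :: "'b \<Rightarrow> 'b \<Rightarrow> ennreal" and V :: "'b \<Rightarrow> ennreal"
  assumes sf: "sigma_finite_measure X"
    and K [measurable]: "(\<lambda>p. K (fst p) (snd p)) \<in> borel_measurable (X \<Otimes>\<^sub>M X)"
    and V [measurable]: "V \<in> borel_measurable X" and S [measurable]: "S \<in> sets X"
    and supp: "\<And>x. x \<notin> S \<Longrightarrow> V x = 0" and sym: "\<And>x y. K x y = K y x"
    and C: "\<And>x. x \<in> S \<Longrightarrow> (\<integral>\<^sup>+y. K x y * indicator S y \<partial>X) \<le> C"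
  shows "(\<integral>\<^sup>+p. K (fst p) (snd p) * (V (fst p) * V (snd p)) \<partial>(X \<Otimes>\<^sub>M X)) \<le> 2 * (C * (\<integral>\<^sup>+x. (V x)\<^sup>2 \<partial>X))"
proof -
  interpret sigma_finite_measure X by fact
  interpret XX: pair_sigma_finite X X ..
  have half: "(\<integral>\<^sup>+x. \<integral>\<^sup>+y. (V x)\<^sup>2 * (K x y * indicator S y) \<partial>X \<partial>X) \<le> C * (\<integral>\<^sup>+x. (V x)\<^sup>2 \<partial>X)"
  proof -
    have "(\<integral>\<^sup>+x. \<integral>\<^sup>+y. (V x)\<^sup>2 * (K x y * indicator S y) \<partial>X \<partial>X) \<le> (\<integral>\<^sup>+x. C * (V x)\<^sup>2 \<partial>X)"
    proof (rule nn_integral_mono)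
      fix x assume [measurable]: "x \<in> space X"
      have [measurable]: "K x \<in> borel_measurable X"
        using measurable_compose[OF measurable_Pair1'[of x X X] K] by simp
      have "(\<integral>\<^sup>+y. (V x)\<^sup>2 * (K x y * indicator S y) \<partial>X) = (V x)\<^sup>2 * (\<integral>\<^sup>+y. K x y * indicator S y \<partial>X)"
        by (rule nn_integral_cmult) measurable
      also have "\<dots> \<le> C * (V x)\<^sup>2"
        using supp[of x] mult_left_mono[OF C[of x], of "(V x)\<^sup>2"] by (cases "x \<in> S") (auto simp: mult.commute[of C])
      finally show "(\<integral>\<^sup>+y. (V x)\<^sup>2 * (K x y * indicator S y) \<partial>X) \<le> C * (V x)\<^sup>2" .
    qed
    then show ?thesis by (simp add: nn_integral_cmult)
  qed
  have K' [measurable]: "(\<lambda>p. K (snd p) (fst p)) \<in> borel_measurable (X \<Otimes>\<^sub>M X)"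
    using measurable_compose[OF measurable_pair_swap' K] by (simp add: case_prod_unfold)
  have "K x y * (V x * V y) \<le> (V x)\<^sup>2 * (K x y * indicator S y) + (V y)\<^sup>2 * (K y x * indicator S x)" for x y
  proof (cases "x \<in> S \<and> y \<in> S")
    case True
    show ?thesis
    proof (cases "V x \<le> V y")
      case le: True
      then have "K x y * (V x * V y) \<le> K x y * (V y * V y)"
        by (intro mult_left_mono mult_right_mono) auto
      with True show ?thesis
        unfolding sym[of y x] power2_eq_square by (auto simp: mult_ac intro: order_trans)
    next
      case False
      then have "K x y * (V x * V y) \<le> K x y * (V x * V x)"
        by (intro mult_left_mono) auto
      with True show ?thesis
        unfolding power2_eq_square by (auto simp: mult_ac intro: order_trans)
    qed
  qed (use supp in auto)
  then have "(\<integral>\<^sup>+p. K (fst p) (snd p) * (V (fst p) * V (snd p)) \<partial>(X \<Otimes>\<^sub>M X))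
    \<le> (\<integral>\<^sup>+p. (V (fst p))\<^sup>2 * (K (fst p) (snd p) * indicator S (snd p)) + (V (snd p))\<^sup>2 * (K (snd p) (fst p) * indicator S (fst p)) \<partial>(X \<Otimes>\<^sub>M X))"
    by (intro nn_integral_mono)
  also have "\<dots> = (\<integral>\<^sup>+p. (V (fst p))\<^sup>2 * (K (fst p) (snd p) * indicator S (snd p)) \<partial>(X \<Otimes>\<^sub>M X))
      + (\<integral>\<^sup>+p. (V (snd p))\<^sup>2 * (K (snd p) (fst p) * indicator S (fst p)) \<partial>(X \<Otimes>\<^sub>M X))"
    by (rule nn_integral_add) measurable
  also have "(\<integral>\<^sup>+p. (V (fst p))\<^sup>2 * (K (fst p) (snd p) * indicator S (snd p)) \<partial>(X \<Otimes>\<^sub>M X))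
      = (\<integral>\<^sup>+x. \<integral>\<^sup>+y. (V x)\<^sup>2 * (K x y * indicator S y) \<partial>X \<partial>X)"
    using nn_integral_fst[of "\<lambda>p. (V (fst p))\<^sup>2 * (K (fst p) (snd p) * indicator S (snd p))" X] by simp
  also have "(\<integral>\<^sup>+p. (V (snd p))\<^sup>2 * (K (snd p) (fst p) * indicator S (fst p)) \<partial>(X \<Otimes>\<^sub>M X))
      = (\<integral>\<^sup>+x. \<integral>\<^sup>+y. (V x)\<^sup>2 * (K x y * indicator S y) \<partial>X \<partial>X)"
    using XX.nn_integral_snd[of "\<lambda>p. (V (snd p))\<^sup>2 * (K (snd p) (fst p) * indicator S (fst p))"] by simp
  finally show ?thesis
    using add_mono[OF half half] by (auto simp: mult_2 intro: order_trans)
qed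

text \<open>Schur's test on triples of parameters with the kernel \<open>gauss_hat e\<close> of the difference of the two
  triple sums. Its bound is independent of \<open>e\<close>, and the square integral over triples is the cube of the
  \<open>L\<^sup>2\<close> mass of \<open>U\<close>.\<close>

lemma local_extension_sextic_finite:
  fixes U :: "real \<Rightarrow> complex"
  assumes U: "integrable lborel U" and supp: "\<And>t. t \<notin> {c..c + pi / 2} \<Longrightarrow> U t = 0"
    and L2: "(\<integral>\<^sup>+t. (ennreal (norm (U t)))\<^sup>2 \<partial>lborel) < \<infinity>"
  shows "(\<integral>\<^sup>+\<xi>. ennreal (norm (osc lborel circle_param U \<xi>) ^ 6) \<partial>lborel) < \<infinity>"
proof -
  let ?I = "{c..c + pi / 2}" and ?V = "prod3 (\<lambda>t. ennreal (norm (U t)))"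
  have [measurable]: "U \<in> borel_measurable borel"
    using U by auto
  have [measurable]: "sum3 circle_param \<in> borel_measurable (cube_measure lborel)"
    by (rule measurable_sum3) measurable
  have V [measurable]: "?V \<in> borel_measurable (cube_measure lborel)"
    by (rule measurable_prod3_ennreal) measurable
  have [measurable]: "osc lborel circle_param U \<in> borel_measurable borel"
    by (rule measurable_osc[OF lborel.sigma_finite_measure_axioms]) auto
  let ?A = "\<integral>\<^sup>+q. (?V q)\<^sup>2 \<partial>cube_measure lborel"
  have A: "?A = (\<integral>\<^sup>+t. (ennreal (norm (U t)))\<^sup>2 \<partial>lborel) ^ 3"
    by (subst nn_integral_cube[OF lborel.sigma_finite_measure_axioms])
       (auto simp: prod3_def power_mult_distrib nn_integral_cmult nn_integral_multc power3_eq_cube mult.assoc)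
  have "(\<integral>\<^sup>+\<xi>. ennreal (norm (osc lborel circle_param U \<xi>) ^ 6) \<partial>lborel) + 0
      \<le> 2 * (ennreal (1152 * pi\<^sup>2) * ?A)"
  proof (rule nn_integral_le_by_gauss)
    fix e :: real assume e: "e > 0"
    have "(\<integral>\<^sup>+\<xi>. ennreal (gauss e \<xi> * norm (osc lborel circle_param U \<xi>) ^ 6) \<partial>lborel)
      \<le> (\<integral>\<^sup>+p. ennreal (gauss_hat e (sum3 circle_param (fst p) - sum3 circle_param (snd p)))
          * (?V (fst p) * ?V (snd p)) \<partial>(cube_measure lborel \<Otimes>\<^sub>M cube_measure lborel))"
      by (rule gauss_weighted_sextic_le[OF e lborel.sigma_finite_measure_axioms _ U]) simp
    also have "\<dots> \<le> 2 * (ennreal (1152 * pi\<^sup>2) * ?A)"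
    proof (rule schur_test)
      show "sigma_finite_measure (cube_measure (lborel :: real measure))"
        by (intro sigma_finite_pair lborel.sigma_finite_measure_axioms)
      show "?I \<times> ?I \<times> ?I \<in> sets (cube_measure lborel)"
        by (intro pair_measureI) auto
      show "?V q = 0" if "q \<notin> ?I \<times> ?I \<times> ?I" for q
        using that supp[of "fst q"] supp[of "fst (snd q)"] supp[of "snd (snd q)"]
        by (cases q) (auto simp: prod3_def)
      show "ennreal (gauss_hat e (sum3 circle_param p - sum3 circle_param q))
        = ennreal (gauss_hat e (sum3 circle_param q - sum3 circle_param p))" for p q
        by (simp add: gauss_hat_def norm_minus_commute)
    qed (use arc_kernel_le[OF e] in \<open>auto simp del: mem_Times_iff\<close>)
    finally show "(\<integral>\<^sup>+\<xi>. ennreal (gauss e \<xi> * norm (osc lborel circle_param U \<xi>) ^ 6) \<partial>lborel) + 0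
      \<le> 2 * (ennreal (1152 * pi\<^sup>2) * ?A)" by simp
  qed auto
  also have "\<dots> < \<infinity>"
    using L2 unfolding A by (simp add: ennreal_mult_less_top power_less_top_ennreal)
  finally show ?thesis by simp
qed

lemma norm_sum_power6_le:
  fixes a :: "nat \<Rightarrow> complex"
  assumes "n > 0"
  shows "norm (\<Sum>j<n. a j) ^ 6 \<le> real n ^ 6 * (\<Sum>j<n. norm (a j) ^ 6)"
proof -
  obtain m where m: "m < n" "\<And>j. j < n \<Longrightarrow> norm (a j) \<le> norm (a m)"
  proof -
    have "finite {..<n}" "{..<n} \<noteq> {}" using assms by auto
    then have "Max ((\<lambda>j. norm (a j)) ` {..<n}) \<in> (\<lambda>j. norm (a j)) ` {..<n}"
      by (intro Max_in) auto
    then obtain m where "m < n" "norm (a m) = Max ((\<lambda>j. norm (a j)) ` {..<n})"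
      by auto
    with that show ?thesis by simp
  qed
  have "norm (\<Sum>j<n. a j) \<le> real n * norm (a m)"
    using sum_norm_bound[of "{..<n}" a "norm (a m)"] m by simp
  then have "norm (\<Sum>j<n. a j) ^ 6 \<le> (real n * norm (a m)) ^ 6"
    by (intro power_mono) auto
  also have "\<dots> \<le> real n ^ 6 * (\<Sum>j<n. norm (a j) ^ 6)"
    unfolding power_mult_distrib using m(1)
    by (intro mult_left_mono member_le_sum[of m "{..<n}" "\<lambda>j. norm (a j) ^ 6"]) auto
  finally show ?thesis .
qed

lemma nn_integral_arc:
  assumes [measurable]: "h \<in> borel_measurable arc_measure"
  shows "(\<integral>\<^sup>+x. h x \<partial>arc_measure) = (\<integral>\<^sup>+t. h (circle_param t) * indicator {0..<2 * pi} t \<partial>lborel)"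
proof -
  have "h \<in> borel_measurable (restrict_space borel S1)"
    using assms by (simp add: arc_measure_def)
  then show ?thesis
    unfolding arc_measure_def
    by (subst nn_integral_distr[OF measurable_circle_param])
       (simp_all add: nn_integral_restrict_space)
qed

lemma ident_measurable_arc: "(\<lambda>x. x) \<in> borel_measurable arc_measure"
  by (simp add: arc_measure_def measurable_restrict_space1)

lemma measurable_arc_param:
  assumes "h \<in> borel_measurable arc_measure"
  shows "(\<lambda>t. h (circle_param t)) \<in> borel_measurable borel"
  using measurable_compose[OF measurable_circle_param_borel, of h borel] assms
  by (simp add: arc_measure_def)

text \<open>The circle is the union of four quarter arcs, and a sum of four functions with finite sixth moment has
  a finite sixth moment.\<close>

lemma arc_extension_sextic_finite:
  assumes fm: "f \<in> borel_measurable arc_measure"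
    and L2: "(\<integral>\<^sup>+x. ennreal ((norm (f x))\<^sup>2) \<partial>arc_measure) < \<infinity>"
  shows "(\<integral>\<^sup>+\<xi>. ennreal (norm (fourier_ext f \<xi>) ^ 6) \<partial>lborel) < \<infinity>"
proof -
  note [measurable] = fm measurable_arc_param[OF fm]
  define I where "I j = {real j * (pi / 2)..<real (Suc j) * (pi / 2)}" for j
  have [measurable]: "I j \<in> sets borel" for j
    unfolding I_def by simp
  define U where "U j t = indicator (I j) t *\<^sub>R f (circle_param t)" for j t
  have Um [measurable]: "U j \<in> borel_measurable borel" for j
    unfolding U_def[abs_def] by measurable
  have I_sub: "indicator (I j) t \<le> (indicator {0..<2 * pi} t :: ennreal)" if "j < 4" for j t
  proof -
    have "real (Suc j) * (pi / 2) \<le> 4 * (pi / 2)"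
      using that by (intro mult_right_mono) auto
    moreover have "0 \<le> real j * (pi / 2)"
      by simp
    ultimately have "I j \<subseteq> {0..<2 * pi}"
      unfolding I_def by (auto simp only: atLeastLessThan_iff)
    then show ?thesis by (auto simp: indicator_def)
  qed
  have L2U: "(\<integral>\<^sup>+t. (ennreal (norm (U j t)))\<^sup>2 \<partial>lborel) < \<infinity>" if "j < 4" for j
  proof -
    have "(\<integral>\<^sup>+t. (ennreal (norm (U j t)))\<^sup>2 \<partial>lborel)
        \<le> (\<integral>\<^sup>+t. ennreal ((norm (f (circle_param t)))\<^sup>2) * indicator {0..<2 * pi} t \<partial>lborel)"
      using I_sub[OF that] by (intro nn_integral_mono) (auto simp: U_def indicator_def ennreal_power split: if_splits)
    also have "\<dots> = (\<integral>\<^sup>+x. ennreal ((norm (f x))\<^sup>2) \<partial>arc_measure)"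
      by (rule nn_integral_arc[symmetric]) measurable
    finally show ?thesis using L2 by simp
  qed
  have intU: "integrable lborel (U j)" if "j < 4" for j
  proof (rule integrableI_bounded)
    have "(\<integral>\<^sup>+t. ennreal (norm (U j t)) \<partial>lborel) \<le> (\<integral>\<^sup>+t. indicator (I j) t + (ennreal (norm (U j t)))\<^sup>2 \<partial>lborel)"
    proof (rule nn_integral_mono)
      fix t
      have "r \<le> 1 + r\<^sup>2" for r :: real
        using zero_le_power2[of "r - 1 / 2"] by (simp add: power2_eq_square algebra_simps)
      then have "ennreal (norm (U j t)) \<le> ennreal (1 + (norm (U j t))\<^sup>2)"
        by (intro ennreal_leI)
      then show "ennreal (norm (U j t)) \<le> indicator (I j) t + (ennreal (norm (U j t)))\<^sup>2"
        by (cases "t \<in> I j") (auto simp: ennreal_power U_def)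
    qed
    also have "\<dots> = emeasure lborel (I j) + (\<integral>\<^sup>+t. (ennreal (norm (U j t)))\<^sup>2 \<partial>lborel)"
      by (subst nn_integral_add) auto
    also have "\<dots> < \<infinity>"
      using L2U[OF that] by (simp add: I_def)
    finally show "(\<integral>\<^sup>+t. ennreal (norm (U j t)) \<partial>lborel) < \<infinity>" .
  qed simp
  have dec: "fourier_ext f \<xi> = (\<Sum>j<4. osc lborel circle_param (U j) \<xi>)" for \<xi>
  proof -
    let ?h = "\<lambda>x. exp (- \<i> * complex_of_real (\<xi> \<bullet> x)) * f x"
    have split: "indicator {0..<2 * pi} t = (\<Sum>j<4. indicator (I j) t :: real)" for t
    proof -
      have "(\<Sum>j<4. indicator (I j) t :: real) = indicator (I 0) t + indicator (I 1) t + indicator (I 2) t + indicator (I 3) t"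
        by (simp add: eval_nat_numeral lessThan_Suc)
      also have "\<dots> = indicator {0..<2 * pi} t"
        by (auto simp: I_def indicator_def)
      finally show ?thesis ..
    qed
    note [measurable] = ident_measurable_arc
    have hm: "?h \<in> borel_measurable (restrict_space borel S1)"
    proof -
      have "?h \<in> borel_measurable arc_measure" by measurable
      then show ?thesis by (simp add: arc_measure_def)
    qed
    have "fourier_ext f \<xi> = (\<integral>t. indicator {0..<2 * pi} t *\<^sub>R ?h (circle_param t) \<partial>lborel)"
      unfolding fourier_ext_def arc_measure_def
      by (subst integral_distr[OF measurable_circle_param hm]) (simp add: integral_restrict_space)
    also have "\<dots> = (\<integral>t. (\<Sum>j<4. exp (- \<i> * complex_of_real (\<xi> \<bullet> circle_param t)) * U j t) \<partial>lborel)"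
      by (simp only: split U_def scaleR_left.sum) (simp add: mult_scaleR_right)
    also have "\<dots> = (\<Sum>j<4. osc lborel circle_param (U j) \<xi>)"
      unfolding osc_def by (intro Bochner_Integration.integral_sum integrable_osc intU) auto
    finally show ?thesis .
  qed
  have [measurable]: "osc lborel circle_param (U j) \<in> borel_measurable borel" for j
    by (rule measurable_osc[OF lborel.sigma_finite_measure_axioms]) auto
  have "(\<integral>\<^sup>+\<xi>. ennreal (norm (fourier_ext f \<xi>) ^ 6) \<partial>lborel)
     \<le> (\<integral>\<^sup>+\<xi>. 4 ^ 6 * (\<Sum>j<4. ennreal (norm (osc lborel circle_param (U j) \<xi>) ^ 6)) \<partial>lborel)"
  proof (rule nn_integral_mono)
    fix \<xi>
    have "norm (fourier_ext f \<xi>) ^ 6 \<le> 4 ^ 6 * (\<Sum>j<4. norm (osc lborel circle_param (U j) \<xi>) ^ 6)"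
      unfolding dec using norm_sum_power6_le[of 4] by simp
    then have "ennreal (norm (fourier_ext f \<xi>) ^ 6) \<le> ennreal (4 ^ 6 * (\<Sum>j<4. norm (osc lborel circle_param (U j) \<xi>) ^ 6))"
      by (rule ennreal_leI)
    then show "ennreal (norm (fourier_ext f \<xi>) ^ 6) \<le> 4 ^ 6 * (\<Sum>j<4. ennreal (norm (osc lborel circle_param (U j) \<xi>) ^ 6))"
      by (simp add: ennreal_mult' sum_nonneg)
  qed
  also have "\<dots> = 4 ^ 6 * (\<Sum>j<4. \<integral>\<^sup>+\<xi>. ennreal (norm (osc lborel circle_param (U j) \<xi>) ^ 6) \<partial>lborel)"
    by (simp add: nn_integral_cmult nn_integral_sum del: sum_ennreal)
  also have "\<dots> < \<infinity>"
  proof -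
    have "(\<integral>\<^sup>+\<xi>. ennreal (norm (osc lborel circle_param (U j) \<xi>) ^ 6) \<partial>lborel) < \<infinity>" if "j < 4" for j
    proof (rule local_extension_sextic_finite[where c = "real j * (pi / 2)"])
      show "U j t = 0" if "t \<notin> {real j * (pi / 2)..real j * (pi / 2) + pi / 2}" for t
        using that by (auto simp: U_def I_def indicator_def algebra_simps)
    qed (use intU[OF that] L2U[OF that] in auto)
    then show ?thesis
      by (simp add: ennreal_mult_less_top)
  qed
  finally show ?thesis .
qed

section \<open>Reflection invariance of arc length\<close>

lemma circle_param_add_pi: "circle_param (t + pi) = - circle_param t"
  by (simp add: circle_param_def vec_eq_iff forall_2)

lemma circle_param_add_2pi: "circle_param (t + 2 * pi) = circle_param t"
  by (simp add: circle_param_def)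

lemma uminus_measurable_arc: "uminus \<in> arc_measure \<rightarrow>\<^sub>M arc_measure"
proof -
  have "uminus \<in> restrict_space borel S1 \<rightarrow>\<^sub>M restrict_space borel S1"
    by (rule measurable_restrict_space3) auto
  then show ?thesis by (simp add: arc_measure_def)
qed

lemma nn_integral_shift_interval:
  fixes G :: "real \<Rightarrow> ennreal"
  assumes [measurable]: "G \<in> borel_measurable borel"
  shows "(\<integral>\<^sup>+t. G (t + s) * indicator {a..<b} t \<partial>lborel) = (\<integral>\<^sup>+t. G t * indicator {a + s..<b + s} t \<partial>lborel)"
proof -
  have "indicator {a + s..<b + s} (s + 1 * t) = (indicator {a..<b} t :: ennreal)" for t
    by (auto simp: indicator_def)
  with nn_integral_real_affine[of "\<lambda>t. G t * indicator {a + s..<b + s} t" 1 s] show ?thesis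
    by (simp add: add.commute)
qed

lemma nn_integral_split_interval:
  fixes G :: "real \<Rightarrow> ennreal"
  assumes "a \<le> b" "b \<le> c" and [measurable]: "G \<in> borel_measurable borel"
  shows "(\<integral>\<^sup>+t. G t * indicator {a..<c} t \<partial>lborel)
      = (\<integral>\<^sup>+t. G t * indicator {a..<b} t \<partial>lborel) + (\<integral>\<^sup>+t. G t * indicator {b..<c} t \<partial>lborel)"
proof -
  have "(\<integral>\<^sup>+t. G t * indicator {a..<c} t \<partial>lborel) = (\<integral>\<^sup>+t. G t * indicator {a..<b} t + G t * indicator {b..<c} t \<partial>lborel)"
    using assms(1,2) by (intro nn_integral_cong) (auto simp: indicator_def)
  then show ?thesis
    by (simp add: nn_integral_add)
qed

text \<open>On the circle the reflection is the shift of the angle by \<open>\<pi>\<close>, which permutes the two halves of a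
  period.\<close>

lemma nn_integral_arc_uminus:
  assumes F: "F \<in> borel_measurable arc_measure"
  shows "(\<integral>\<^sup>+x. F (- x) \<partial>arc_measure) = (\<integral>\<^sup>+x. F x \<partial>arc_measure)"
proof -
  define H where "H t = F (circle_param t)" for t
  have Hm: "H \<in> borel_measurable borel"
    unfolding H_def[abs_def] by (rule measurable_arc_param[OF F])
  then have Hm': "(\<lambda>t. H (t + pi)) \<in> borel_measurable borel"
    by simp
  have H_pi: "F (- circle_param t) = H (t + pi)" for t
    by (simp add: H_def circle_param_add_pi)
  have H_2pi: "H (t + 2 * pi) = H t" for t
    unfolding H_def circle_param_add_2pi ..
  let ?J = "\<lambda>a b. \<integral>\<^sup>+t. H t * indicator {a..<b} t \<partial>lborel"
  have "(\<integral>\<^sup>+x. F (- x) \<partial>arc_measure) = (\<integral>\<^sup>+t. F (- circle_param t) * indicator {0..<2 * pi} t \<partial>lborel)"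
    by (rule nn_integral_arc[OF measurable_compose[OF uminus_measurable_arc F]])
  also have "\<dots> = (\<integral>\<^sup>+t. H (t + pi) * indicator {0..<pi} t \<partial>lborel) + (\<integral>\<^sup>+t. H (t + pi) * indicator {pi..<2 * pi} t \<partial>lborel)"
    unfolding H_pi by (rule nn_integral_split_interval[OF _ _ Hm']) auto
  also have "(\<integral>\<^sup>+t. H (t + pi) * indicator {0..<pi} t \<partial>lborel) = ?J (0 + pi) (pi + pi)"
    by (rule nn_integral_shift_interval[OF Hm])
  also have "(\<integral>\<^sup>+t. H (t + pi) * indicator {pi..<2 * pi} t \<partial>lborel) = ?J (pi + pi) (2 * pi + pi)"
    by (rule nn_integral_shift_interval[OF Hm])
  also have "\<dots> = ?J (0 + 2 * pi) (pi + 2 * pi)"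
    by (simp only: mult_2 add_ac add_0_left)
  also have "\<dots> = (\<integral>\<^sup>+t. H (t + 2 * pi) * indicator {0..<pi} t \<partial>lborel)"
    by (rule nn_integral_shift_interval[OF Hm, symmetric])
  also have "\<dots> = ?J 0 pi"
    unfolding H_2pi ..
  also have "?J (0 + pi) (pi + pi) + ?J 0 pi = ?J 0 pi + ?J pi (2 * pi)"
    by (simp only: add.commute[of "?J 0 pi"] mult_2 add_0_left)
  also have "\<dots> = ?J 0 (2 * pi)"
    by (rule nn_integral_split_interval[OF _ _ Hm, symmetric]) auto
  also have "\<dots> = (\<integral>\<^sup>+x. F x \<partial>arc_measure)"
    unfolding H_def by (rule nn_integral_arc[OF F, symmetric])
  finally show ?thesis .
qed

section \<open>Energies on the circle\<close>

interpretation arc: finite_measure arc_measure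
  by (rule finite_measureI) (simp add: space_arc_measure emeasure_arc_measure_S1)

interpretation arc: symmetric_measure arc_measure
proof
  show "(\<lambda>x. x) \<in> borel_measurable arc_measure"
    by (rule ident_measurable_arc)
  show "uminus \<in> arc_measure \<rightarrow>\<^sub>M arc_measure"
    by (rule uminus_measurable_arc)
  show "(\<integral>\<^sup>+x. F (- x) \<partial>arc_measure) = (\<integral>\<^sup>+x. F x \<partial>arc_measure)"
    if "F \<in> borel_measurable arc_measure" for F
    by (rule nn_integral_arc_uminus[OF that])
qed

lemma fourier_ext_eq_osc: "fourier_ext f = osc arc_measure (\<lambda>x. x) f"
  by (simp add: fun_eq_iff fourier_ext_def osc_def)

text \<open>The powers \<open>L2_mass\<close> and \<open>sextic_energy\<close> of the two norms are integrals, hence additive and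
  well suited to monotone limits; \<open>Lp_norm_2_arc\<close> and \<open>Lp_norm_6_plane\<close> take the roots.\<close>

definition L2_mass :: "(real ^ 2 \<Rightarrow> complex) \<Rightarrow> ennreal" where
  "L2_mass f = (\<integral>\<^sup>+x. ennreal ((norm (f x))\<^sup>2) \<partial>arc_measure)"

definition sextic_energy :: "(real ^ 2 \<Rightarrow> complex) \<Rightarrow> ennreal" where
  "sextic_energy f = (\<integral>\<^sup>+\<xi>. ennreal (norm (fourier_ext f \<xi>) ^ 6) \<partial>lborel)"

lemma integrable_arc:
  assumes [measurable]: "f \<in> borel_measurable arc_measure" and "L2_mass f < \<infinity>"
  shows "integrable arc_measure f"
proof -
  have "integrable arc_measure (\<lambda>x. (f x)\<^sup>2)"
  proof (rule integrableI_bounded)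
    show "(\<integral>\<^sup>+x. ennreal (norm ((f x)\<^sup>2)) \<partial>arc_measure) < \<infinity>"
      using assms(2) unfolding L2_mass_def norm_power .
  qed measurable
  then show ?thesis
    by (rule arc.square_integrable_imp_integrable[OF assms(1)])
qed

lemma measurable_fourier_ext:
  assumes "f \<in> borel_measurable arc_measure"
  shows "fourier_ext f \<in> borel_measurable borel"
  unfolding fourier_ext_eq_osc
  by (rule measurable_osc[OF arc.sigma_finite_measure_axioms ident_measurable_arc assms])

text \<open>The Gaussian weight is removed from the first term by a monotone limit. The excess term increases
  as \<open>e\<close> decreases, so along the limit it may be kept at its value for \<open>e = 1\<close>.\<close>

lemma sextic_energy_superadditive:
  assumes f [measurable]: "f \<in> borel_measurable arc_measure" and L2: "L2_mass f < \<infinity>"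
    and ms: "L2_mass (\<lambda>x. complex_of_real (antipodal_mean (\<lambda>x. norm (f x)) x)) < \<infinity>"
  shows "sextic_energy f + arc.six (antipodal_excess (\<lambda>x. norm (f x))) (gauss_hat 1) 0
    \<le> sextic_energy (\<lambda>x. complex_of_real (antipodal_mean (\<lambda>x. norm (f x)) x))"
proof -
  let ?g = "\<lambda>x. norm (f x)"
  let ?s = "antipodal_mean ?g" and ?u = "antipodal_excess ?g"
  have sm [measurable]: "?s \<in> borel_measurable arc_measure"
    unfolding antipodal_mean_def[abs_def] by measurable
  have um [measurable]: "?u \<in> borel_measurable arc_measure"
    unfolding antipodal_excess_def[abs_def] by measurable
  have si: "integrable arc_measure ?s"
    using integrable_arc[OF _ ms] by (simp add: complex_of_real_integrable_eq)
  have ui: "integrable arc_measure ?u"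
    by (rule Bochner_Integration.integrable_bound[OF si]) (auto intro!: antipodal_excess_le)
  have e1: "arc.six ?u (gauss_hat 1) 0 \<le> arc.six ?u (gauss_hat e) 0" if e: "0 < e" "e \<le> 1" for e
    unfolding arc.gauss_weighted_extension_eq[OF e(1) ui antipodal_excess_nonneg, symmetric]
      arc.gauss_weighted_extension_eq[OF zero_less_one ui antipodal_excess_nonneg, symmetric]
    by (intro nn_integral_mono ennreal_leI mult_right_mono gauss_mono e) auto
  show ?thesis
    unfolding sextic_energy_def
  proof (rule nn_integral_le_by_gauss)
    show "(\<lambda>\<xi>. norm (fourier_ext f \<xi>) ^ 6) \<in> borel_measurable borel"
      using measurable_fourier_ext[OF f] by measurable
    fix e :: real assume e: "0 < e" "e \<le> 1"
    have "(\<integral>\<^sup>+\<xi>. ennreal (gauss e \<xi> * norm (fourier_ext f \<xi>) ^ 6) \<partial>lborel) + arc.six ?u (gauss_hat 1) 0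
      \<le> arc.six ?g (gauss_hat e) 0 + arc.six ?u (gauss_hat e) 0"
      unfolding fourier_ext_eq_osc
      by (intro add_mono e1 e arc.gauss_weighted_extension_le integrable_arc f L2)
    also have "\<dots> \<le> arc.six ?s (gauss_hat e) 0"
      by (rule arc.six_superadditive) auto
    also have "\<dots> = (\<integral>\<^sup>+\<xi>. ennreal (gauss e \<xi> * norm (fourier_ext (\<lambda>x. complex_of_real (?s x)) \<xi>) ^ 6) \<partial>lborel)"
      unfolding fourier_ext_eq_osc by (rule arc.gauss_weighted_extension_eq[OF e(1) si, symmetric]) simp
    also have "\<dots> \<le> (\<integral>\<^sup>+\<xi>. ennreal (norm (fourier_ext (\<lambda>x. complex_of_real (?s x)) \<xi>) ^ 6) \<partial>lborel)"
      using e by (intro nn_integral_mono ennreal_leI mult_left_le_one_le) (auto simp: gauss_def)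
    finally show "(\<integral>\<^sup>+\<xi>. ennreal (gauss e \<xi> * norm (fourier_ext f \<xi>) ^ 6) \<partial>lborel) + arc.six ?u (gauss_hat 1) 0
      \<le> (\<integral>\<^sup>+\<xi>. ennreal (norm (fourier_ext (\<lambda>x. complex_of_real (?s x)) \<xi>) ^ 6) \<partial>lborel)" .
  qed simp
qed

lemma L2_mass_antipodal_mean:
  assumes [measurable]: "f \<in> borel_measurable arc_measure"
  shows "L2_mass (\<lambda>x. complex_of_real (antipodal_mean (\<lambda>x. norm (f x)) x)) = L2_mass f"
proof -
  have [measurable]: "(\<lambda>x. f (- x)) \<in> borel_measurable arc_measure"
    by measurable
  have half: "ennreal ((A + B) / 2) = ennreal (1 / 2) * (ennreal A + ennreal B)" if "0 \<le> A" "0 \<le> B" for A B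
  proof -
    have "ennreal (1 / 2 * (A + B)) = ennreal (1 / 2) * ennreal (A + B)"
      using that by (intro ennreal_mult) auto
    also have "ennreal (A + B) = ennreal A + ennreal B"
      using that by (rule ennreal_plus)
    finally show ?thesis
      by (simp only: times_divide_eq_left mult_1_left)
  qed
  have "L2_mass (\<lambda>x. complex_of_real (antipodal_mean (\<lambda>x. norm (f x)) x))
      = (\<integral>\<^sup>+x. ennreal (1 / 2) * (ennreal ((norm (f x))\<^sup>2) + ennreal ((norm (f (- x)))\<^sup>2)) \<partial>arc_measure)"
    unfolding L2_mass_def by (intro nn_integral_cong) (simp add: antipodal_mean_def half)
  also have "\<dots> = ennreal (1 / 2) * (L2_mass f + (\<integral>\<^sup>+x. ennreal ((norm (f (- x)))\<^sup>2) \<partial>arc_measure))"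
    unfolding L2_mass_def by (subst nn_integral_cmult, measurable) (simp add: nn_integral_add)
  also have "(\<integral>\<^sup>+x. ennreal ((norm (f (- x)))\<^sup>2) \<partial>arc_measure) = L2_mass f"
    unfolding L2_mass_def by (rule nn_integral_arc_uminus[of "\<lambda>x. ennreal ((norm (f x))\<^sup>2)"]) measurable
  also have "ennreal (1 / 2) * (L2_mass f + L2_mass f) = (ennreal (1 / 2) * ennreal 2) * L2_mass f"
    by (simp add: mult_2 distrib_left distrib_right mult.assoc)
  also have "ennreal (1 / 2) * ennreal 2 = 1"
    by (subst ennreal_mult[symmetric]) auto
  finally show ?thesis by simp
qed

section \<open>Extremizers\<close>

lemma Lp_norm_eq_powr:
  assumes "I = (\<integral>\<^sup>+x. ennreal (norm (f x) powr p) \<partial>M)" and "I < \<infinity>"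
  shows "Lp_norm p M f = ennreal (enn2real I powr (1 / p))"
  using assms by (simp add: Lp_norm_def Let_def)

lemma Lp_norm_2_arc: "L2_mass f < \<infinity> \<Longrightarrow> Lp_norm 2 arc_measure f = ennreal (sqrt (enn2real (L2_mass f)))"
  by (subst Lp_norm_eq_powr[of "L2_mass f"]) (auto simp: L2_mass_def powr_half_sqrt)

lemma Lp_norm_6_plane:
  "sextic_energy f < \<infinity> \<Longrightarrow>
    Lp_norm 6 lborel (fourier_ext f) = ennreal (root 6 (enn2real (sextic_energy f)))"
  by (subst Lp_norm_eq_powr[of "sextic_energy f"]) (auto simp: sextic_energy_def root_powr_inverse)

lemma in_Lp_2_arc_iff: "in_Lp 2 arc_measure f \<longleftrightarrow> f \<in> borel_measurable arc_measure \<and> L2_mass f < \<infinity>"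
proof -
  have "(\<integral>\<^sup>+x. ennreal (norm (f x) powr 2) \<partial>arc_measure) = L2_mass f"
    by (simp add: L2_mass_def)
  then show ?thesis
    by (auto simp: in_Lp_def Lp_norm_def Let_def less_top)
qed

lemma sextic_energy_finite:
  assumes "f \<in> borel_measurable arc_measure" "L2_mass f < \<infinity>"
  shows "sextic_energy f < \<infinity>"
  using arc_extension_sextic_finite[of f] assms unfolding sextic_energy_def L2_mass_def by blast

text \<open>The supremum runs over functions of norm \<open>1\<close> only; homogeneity extends the bound.\<close>

lemma restriction_const_bound:
  assumes f: "f \<in> borel_measurable arc_measure" and fin: "L2_mass f < \<infinity>" and nz: "L2_mass f \<noteq> 0"
  shows "Lp_norm 6 lborel (fourier_ext f) \<le> restriction_const * Lp_norm 2 arc_measure f"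
proof -
  define N where "N = sqrt (enn2real (L2_mass f))"
  have "0 < enn2real (L2_mass f)"
    using fin nz by (simp add: enn2real_positive_iff zero_less_iff_neq_zero)
  then have N: "N > 0"
    by (simp add: N_def)
  define h where "h x = complex_of_real (1 / N) * f x" for x
  have hm: "h \<in> borel_measurable arc_measure"
    unfolding h_def[abs_def] using f by (intro borel_measurable_times borel_measurable_const)
  have "L2_mass h = (\<integral>\<^sup>+x. ennreal (1 / N\<^sup>2) * ennreal ((norm (f x))\<^sup>2) \<partial>arc_measure)"
    unfolding L2_mass_def h_def
    by (intro nn_integral_cong) (simp add: ennreal_mult[symmetric] norm_mult norm_divide power_mult_distrib power_divide)
  also have "\<dots> = ennreal (1 / N\<^sup>2) * L2_mass f"
    unfolding L2_mass_def by (rule nn_integral_cmult) (use f in measurable)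
  also have "L2_mass f = ennreal (N\<^sup>2)"
    using fin by (simp add: N_def)
  also have "ennreal (1 / N\<^sup>2) * ennreal (N\<^sup>2) = 1"
    using N by (subst ennreal_mult[symmetric]) auto
  finally have h1: "L2_mass h = 1" .
  have ext: "fourier_ext h \<xi> = complex_of_real (1 / N) * fourier_ext f \<xi>" for \<xi>
    unfolding fourier_ext_def h_def by (subst integral_mult_right_zero[symmetric]) (simp add: mult_ac)
  have hE: "sextic_energy h < \<infinity>"
    using sextic_energy_finite[OF hm] h1 by simp
  have fE: "sextic_energy f < \<infinity>"
    by (rule sextic_energy_finite[OF f fin])
  have "sextic_energy f = (\<integral>\<^sup>+\<xi>. ennreal (N ^ 6) * ennreal (norm (fourier_ext h \<xi>) ^ 6) \<partial>lborel)"
    unfolding sextic_energy_def ext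
    using N by (intro nn_integral_cong) (simp add: ennreal_mult[symmetric] norm_mult norm_divide power_mult_distrib power_divide)
  also have "\<dots> = ennreal (N ^ 6) * sextic_energy h"
  proof -
    have "(\<lambda>\<xi>. ennreal (norm (fourier_ext h \<xi>) ^ 6)) \<in> borel_measurable lborel"
      using measurable_compose[OF measurable_fourier_ext[OF hm], of "\<lambda>z. ennreal (norm z ^ 6)" borel] by simp
    then show ?thesis
      unfolding sextic_energy_def by (rule nn_integral_cmult)
  qed
  finally have "enn2real (sextic_energy f) = N ^ 6 * enn2real (sextic_energy h)"
    using N by (simp add: enn2real_mult)
  then have "Lp_norm 6 lborel (fourier_ext f) = ennreal (N * root 6 (enn2real (sextic_energy h)))"
    using N by (simp add: Lp_norm_6_plane[OF fE] real_root_mult real_root_power_cancel)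
  also have "\<dots> = Lp_norm 6 lborel (fourier_ext h) * ennreal N"
    using N by (simp add: Lp_norm_6_plane[OF hE] ennreal_mult mult.commute)
  also have "\<dots> \<le> restriction_const * ennreal N"
  proof (rule mult_right_mono)
    have "in_Lp 2 arc_measure h" "Lp_norm 2 arc_measure h = 1"
      using hm h1 by (simp_all add: in_Lp_2_arc_iff Lp_norm_2_arc)
    then show "Lp_norm 6 lborel (fourier_ext h) \<le> restriction_const"
      unfolding restriction_const_def by (intro Sup_upper) blast
  qed simp
  also have "ennreal N = Lp_norm 2 arc_measure f"
    by (simp add: Lp_norm_2_arc[OF fin] N_def)
  finally show ?thesis .
qed

text \<open>Since \<open>h\<close> and \<open>f\<close> have the same mass, the bound on the norm of the extension of \<open>h\<close> is exactly the norm of the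
  extension of \<open>f\<close>. Both are finite, so the sixth powers can be compared.\<close>

lemma extremizer_maximizes_energy:
  assumes f: "extremizer f"
    and h: "h \<in> borel_measurable arc_measure" "L2_mass h = L2_mass f"
  shows "sextic_energy h \<le> sextic_energy f"
proof -
  have fm: "f \<in> borel_measurable arc_measure" and fin: "L2_mass f < \<infinity>"
    and ext: "Lp_norm 6 lborel (fourier_ext f) = restriction_const * Lp_norm 2 arc_measure f"
    using f by (auto simp: extremizer_def in_Lp_2_arc_iff)
  have nz: "L2_mass f \<noteq> 0"
  proof
    assume "L2_mass f = 0"
    then have "AE x in arc_measure. ennreal ((norm (f x))\<^sup>2) = 0"
      unfolding L2_mass_def by (subst (asm) nn_integral_0_iff_AE) (use fm in measurable)
    then have "AE x in arc_measure. f x = 0"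
      by (rule eventually_mono) simp
    with f show False by (simp add: extremizer_def)
  qed
  have hE: "sextic_energy h < \<infinity>" and fE: "sextic_energy f < \<infinity>"
    using sextic_energy_finite fm fin h by auto
  have "Lp_norm 6 lborel (fourier_ext h) \<le> restriction_const * Lp_norm 2 arc_measure h"
    by (rule restriction_const_bound) (use h fin nz in auto)
  also have "\<dots> = Lp_norm 6 lborel (fourier_ext f)"
    using fin by (simp add: ext Lp_norm_2_arc h)
  finally have "root 6 (enn2real (sextic_energy h)) \<le> root 6 (enn2real (sextic_energy f))"
    unfolding Lp_norm_6_plane[OF hE] Lp_norm_6_plane[OF fE] by simp
  then show ?thesis
    using ennreal_leI[of "enn2real (sextic_energy h)" "enn2real (sextic_energy f)"] hE fE
    by (simp only: real_root_le_iff zero_less_numeral ennreal_enn2real infinity_ennreal_def)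
qed

theorem theorem1p3:
  fixes f :: "real ^ 2 \<Rightarrow> complex"
  assumes "extremizer f"
  shows "AE x in arc_measure. norm (f (- x)) = norm (f x)"
proof -
  let ?g = "\<lambda>x. norm (f x)"
  let ?s = "\<lambda>x. complex_of_real (antipodal_mean ?g x)" and ?u = "antipodal_excess ?g"
  have fm [measurable]: "f \<in> borel_measurable arc_measure" and fin: "L2_mass f < \<infinity>"
    using assms by (auto simp: extremizer_def in_Lp_2_arc_iff)
  have sm: "?s \<in> borel_measurable arc_measure"
    unfolding antipodal_mean_def by measurable
  have um: "(\<lambda>x. ennreal (?u x)) \<in> borel_measurable arc_measure"
    unfolding antipodal_excess_def antipodal_mean_def by measurable
  have "sextic_energy f + arc.six ?u (gauss_hat 1) 0 \<le> sextic_energy ?s"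
    by (rule sextic_energy_superadditive) (simp_all add: fm fin[simplified] L2_mass_antipodal_mean)
  also have "\<dots> \<le> sextic_energy f"
    by (rule extremizer_maximizes_energy[OF assms sm L2_mass_antipodal_mean[OF fm]])
  \<comment> \<open>Cancelling the energy of \<open>f\<close> requires that it is finite.\<close>
  finally have "\<not> 0 < arc.six ?u (gauss_hat 1) 0"
    using sextic_energy_finite[OF fm fin] by (auto simp: ennreal_add_left_cancel_le[of _ _ 0, simplified])
  then have "AE x in arc_measure. ennreal (?u x) = 0"
    using arc.six_pos[OF um, of "\<lambda>v. ennreal (gauss_hat 1 v)" 0] by (auto simp: gauss_hat_def)
  then have le: "AE x in arc_measure. norm (f x) \<le> norm (f (- x))"
  proof (rule eventually_mono)
    fix x assume "ennreal (?u x) = 0"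
    then show "norm (f x) \<le> norm (f (- x))"
      using mean_less_antipodal_mean[of ?g x] by (auto simp: antipodal_excess_def split: if_splits)
  qed
  \<comment> \<open>The reverse inequality is the reflection of the first one.\<close>
  have "AE x in arc_measure. norm (f (- x)) \<le> norm (f (- (- x)))"
    using le by (subst arc.AE_uminus[of "\<lambda>x. norm (f x) \<le> norm (f (- x))"]) measurable
  with le show ?thesis
    by eventually_elim simp
qed

end
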